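(* Let $\mathcal{H}$ be a space of the class $\mathfrak{R}$, with Riesz basis of normalized reproducing kernels at the points $T=\{t_n\}$ and associated weights $\{b_n\}$. Suppose there exists $N>0$ such that $$\inf_m b_m(1+|t_m|)^N>0.$$ Then, for every exact system of reproducing kernels in $\mathcal{H}$, the orthogonal complement in $\mathcal{H}$ to its biorthogonal system is finite-dimensional. If, moreover, $\sum_n b_n=+\infty$, then any system biorthogonal to an exact system of reproducing kernels is complete in $\mathcal{H}$.
   Context: A system of vectors $\{v_n\}$ in a Hilbert space $\mathcal{H}$ is complete if its closed linear span is $\mathcal{H}$; it is exact if it is complete and fails to be complete when any one vector is removed. An exact system $\{v_n\}$ has a unique biorthogonal system $\{w_m\}\subset\mathcal{H}$, i.e. $\langle v_n,w_m\rangle=\delta_{nm}$. A Riesz basis is the image of an orthonormal basis under a bounded invertible operator. The class $\mathfrak{R}$ consists of the (separable) Hilbert spaces $\mathcal{H}$ of entire functions such that: (A1) for every $\lambda\in\mathbb{C}$ there is $k_\lambda\in\mathcal{H}$ (the reproducing kernel) with $\langle f,k_\lambda\rangle=f(\lambda)$ for all $f\in\mathcal{H}$; (A2) if $f\in\mathcal{H}$ and $f(w)=0$, then $\frac{f(z)}{z-w}\in\mathcal{H}$; (A3) there is a sequence of distinct points $T=\{t_n\}\subset\mathbb{C}$ such that $\{k_{t_n}/\|k_{t_n}\|_{\mathcal{H}}\}$ is a Riesz basis of $\mathcal{H}$. The sequence $T$ is infinite and is fixed. The generating function $F$ of $T$ is the entire function, unique up to a nonzero multiplicative constant, such that the system biorthogonal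 to $\{k_{t_n}/\|k_{t_n}\|_{\mathcal{H}}\}$ is $\left\{\frac{\|k_{t_n}\|_{\mathcal{H}}}{F'(t_n)}\cdot\frac{F(z)}{z-t_n}\right\}$. The weights are $b_n:=\|k_{t_n}\|_{\mathcal{H}}^2/|F'(t_n)|^2$. *)

theory Defs
  imports "HOL-Complex_Analysis.Complex_Analysis" "HOL-Library.Function_Algebras"
begin

definition cscale :: "complex \<Rightarrow> (complex \<Rightarrow> complex) \<Rightarrow> (complex \<Rightarrow> complex)" where
  "cscale c f = (\<lambda>z. c * f z)"

interpretation cfun: vector_space cscale
  by unfold_locales (auto simp: cscale_def fun_eq_iff algebra_simps)

text \<open>Inner products are linear in the first argument. Nothing is assumed about
  the value of \<open>ip\<close> on functions outside \<open>H\<close>.\<close>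

locale pre_hilbert =
  fixes H :: "(complex \<Rightarrow> complex) set"
    and ip :: "(complex \<Rightarrow> complex) \<Rightarrow> (complex \<Rightarrow> complex) \<Rightarrow> complex"
  assumes subspace_H: "cfun.subspace H"
    and ip_add: "\<lbrakk>f \<in> H; g \<in> H; h \<in> H\<rbrakk> \<Longrightarrow> ip (f + g) h = ip f h + ip g h"
    and ip_scale: "\<lbrakk>f \<in> H; h \<in> H\<rbrakk> \<Longrightarrow> ip (cscale c f) h = c * ip f h"
    and ip_cnj: "\<lbrakk>f \<in> H; g \<in> H\<rbrakk> \<Longrightarrow> ip g f = cnj (ip f g)"
    and ip_nonneg: "f \<in> H \<Longrightarrow> 0 \<le> Re (ip f f)"
    and ip_definite: "\<lbrakk>f \<in> H; ip f f = 0\<rbrakk> \<Longrightarrow> f = 0"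
begin

definition hnorm :: "(complex \<Rightarrow> complex) \<Rightarrow> real" where
  "hnorm f = sqrt (Re (ip f f))"

text \<open>The value off \<open>H\<close> is irrelevant; it is set to zero because \<open>Metric_space\<close> requires
  nonnegativity and symmetry of the distance on the whole type.\<close>

definition hdist :: "(complex \<Rightarrow> complex) \<Rightarrow> (complex \<Rightarrow> complex) \<Rightarrow> real" where
  "hdist f g = (if f \<in> H \<and> g \<in> H then hnorm (f - g) else 0)"

lemma diff_mem: "\<lbrakk>f \<in> H; g \<in> H\<rbrakk> \<Longrightarrow> f - g \<in> H"
  using subspace_H by (rule cfun.subspace_diff)

lemma add_mem: "\<lbrakk>f \<in> H; g \<in> H\<rbrakk> \<Longrightarrow> f + g \<in> H"
  using subspace_H by (rule cfun.subspace_add)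

lemma scale_mem: "f \<in> H \<Longrightarrow> cscale c f \<in> H"
  using subspace_H by (rule cfun.subspace_scale)

lemma zero_mem: "0 \<in> H"
  using subspace_H by (rule cfun.subspace_0)

lemma ip_add_right:
  assumes "f \<in> H" "g \<in> H" "h \<in> H"
  shows "ip h (f + g) = ip h f + ip h g"
  using assms ip_cnj[of "f + g" h] ip_cnj[of f h] ip_cnj[of g h]
  by (simp add: add_mem ip_add)

lemma ip_scale_right:
  assumes "f \<in> H" "h \<in> H"
  shows "ip h (cscale c f) = cnj c * ip h f"
  using assms ip_cnj[of "cscale c f" h] ip_cnj[of f h]
  by (simp add: scale_mem ip_scale)

lemma ip_self: "f \<in> H \<Longrightarrow> ip f f = of_real ((hnorm f)\<^sup>2)"
  using ip_cnj[of f f] ip_nonneg[of f] by (auto simp: hnorm_def complex_eq_iff)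

lemma hnorm_nonneg: "f \<in> H \<Longrightarrow> 0 \<le> hnorm f"
  by (simp add: hnorm_def ip_nonneg)

lemma hnorm_eq_0:
  assumes "f \<in> H"
  shows "hnorm f = 0 \<longleftrightarrow> f = 0"
proof
  assume "hnorm f = 0"
  then show "f = 0" using assms ip_definite ip_self by simp
next
  assume "f = 0"
  then have "ip f f = 0"
    using ip_scale[of 0 0 0] zero_mem by (simp add: cscale_def zero_fun_def)
  then show "hnorm f = 0" by (simp add: hnorm_def)
qed

lemma hnorm_scale:
  assumes f: "f \<in> H"
  shows "hnorm (cscale c f) = cmod c * hnorm f"
proof -
  have "ip (cscale c f) (cscale c f) = (c * cnj c) * ip f f"
    using f by (simp add: ip_scale ip_scale_right scale_mem)
  also have "\<dots> = of_real ((cmod c)\<^sup>2 * (hnorm f)\<^sup>2)"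
    by (simp only: complex_norm_square[symmetric] ip_self[OF f] of_real_mult)
  finally have "Re (ip (cscale c f) (cscale c f)) = (cmod c * hnorm f)\<^sup>2"
    by (simp add: power_mult_distrib del: of_real_mult of_real_power)
  then show ?thesis
    unfolding hnorm_def[of "cscale c f"] using f by (simp add: hnorm_nonneg)
qed

lemma Cauchy_Schwarz:
  assumes f: "f \<in> H" and g: "g \<in> H"
  shows "cmod (ip f g) \<le> hnorm f * hnorm g"
proof (cases "g = 0")
  case True
  then have "ip f g = 0"
    using ip_scale_right[of 0 f 0] f zero_mem by (simp add: cscale_def zero_fun_def)
  then show ?thesis using f g by (simp add: hnorm_nonneg)
next
  case False
  define a where "a = ip f g"
  define G where "G = (hnorm g)\<^sup>2"
  have G: "G > 0" using False g hnorm_eq_0 by (simp add: G_def)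
  define c where "c = - a / of_real G"
  have m: "cscale c g \<in> H" using g by (rule scale_mem)
  have "ip (f + cscale c g) (f + cscale c g)
      = ip f f + cnj c * a + c * cnj a + c * cnj c * of_real G"
    using f g m ip_cnj[of f g]
    by (simp add: ip_add ip_add_right add_mem ip_scale ip_scale_right ip_self[of g]
        a_def G_def algebra_simps)
  also have "\<dots> = of_real ((hnorm f)\<^sup>2) - a * cnj a / of_real G"
    using G f by (simp add: c_def ip_self field_simps)
  also have "\<dots> = of_real ((hnorm f)\<^sup>2 - (cmod a)\<^sup>2 / G)"
    by (simp only: complex_norm_square[symmetric] of_real_diff of_real_divide)
  finally have "0 \<le> (hnorm f)\<^sup>2 - (cmod a)\<^sup>2 / G"
    using ip_nonneg[OF add_mem[OF f m]] by simp
  then have "(cmod a)\<^sup>2 \<le> (hnorm f * hnorm g)\<^sup>2"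
    using G by (simp add: field_simps G_def power_mult_distrib)
  then show ?thesis
    unfolding a_def using f g by (simp add: abs_le_square_iff[symmetric] hnorm_nonneg)
qed

lemma hnorm_triangle:
  assumes f: "f \<in> H" and g: "g \<in> H"
  shows "hnorm (f + g) \<le> hnorm f + hnorm g"
proof (rule power2_le_imp_le)
  have "(hnorm (f + g))\<^sup>2 = Re (ip (f + g) (f + g))"
    using f g by (simp add: hnorm_def add_mem ip_nonneg)
  also have "\<dots> = (hnorm f)\<^sup>2 + 2 * Re (ip f g) + (hnorm g)\<^sup>2"
  proof -
    have "ip (f + g) (f + g) = ip f f + ip f g + cnj (ip f g) + ip g g"
      using f g ip_cnj[of f g] by (simp add: ip_add ip_add_right add_mem)
    then show ?thesis
      using f g by (simp add: hnorm_def ip_nonneg)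
  qed
  also have "Re (ip f g) \<le> hnorm f * hnorm g"
    using complex_Re_le_cmod[of "ip f g"] Cauchy_Schwarz[OF f g] by linarith
  finally show "(hnorm (f + g))\<^sup>2 \<le> (hnorm f + hnorm g)\<^sup>2"
    by (simp add: power2_sum)
  show "0 \<le> hnorm f + hnorm g" using f g by (simp add: hnorm_nonneg)
qed

sublocale Metric_space H hdist
proof
  fix f g h
  show "0 \<le> hdist f g" by (simp add: hdist_def hnorm_nonneg diff_mem)
  have "hnorm (f - g) = hnorm (g - f)" if "f \<in> H" "g \<in> H"
  proof -
    have "f - g = cscale (-1) (g - f)" by (simp add: cscale_def fun_eq_iff)
    then have "hnorm (f - g) = cmod (-1) * hnorm (g - f)"
      using that hnorm_scale[OF diff_mem, of g f "-1"] by (simp only:)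
    then show ?thesis by simp
  qed
  then show "hdist f g = hdist g f" by (simp add: hdist_def)
  assume f: "f \<in> H" and g: "g \<in> H"
  then show "hdist f g = 0 \<longleftrightarrow> f = g" by (simp add: hdist_def hnorm_eq_0 diff_mem)
  assume h: "h \<in> H"
  have "f - h = (f - g) + (g - h)" by simp
  then show "hdist f h \<le> hdist f g + hdist g h"
    using hnorm_triangle[OF diff_mem[OF f g] diff_mem[OF g h]] f g h
    by (simp add: hdist_def)
qed

text \<open>A system of vectors is a family \<open>v\<close> restricted to an index set \<open>I\<close>.\<close>

definition complete_system :: "('i \<Rightarrow> complex \<Rightarrow> complex) \<Rightarrow> 'i set \<Rightarrow> bool" where
  "complete_system v I \<longleftrightarrow> v ` I \<subseteq> H \<and> mtopology closure_of (cfun.span (v ` I)) = H"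

definition exact_system :: "('i \<Rightarrow> complex \<Rightarrow> complex) \<Rightarrow> 'i set \<Rightarrow> bool" where
  "exact_system v I \<longleftrightarrow>
     complete_system v I \<and> (\<forall>i\<in>I. \<not> complete_system v (I - {i}))"

definition biorthogonal ::
  "('i \<Rightarrow> complex \<Rightarrow> complex) \<Rightarrow> ('i \<Rightarrow> complex \<Rightarrow> complex) \<Rightarrow> 'i set \<Rightarrow> bool" where
  "biorthogonal v w I \<longleftrightarrow> v ` I \<subseteq> H \<and> w ` I \<subseteq> H \<and>
     (\<forall>n\<in>I. \<forall>m\<in>I. ip (v n) (w m) = (if n = m then 1 else 0))"

definition orthonormal_basis :: "('i \<Rightarrow> complex \<Rightarrow> complex) \<Rightarrow> 'i set \<Rightarrow> bool" where
  "orthonormal_basis e I \<longleftrightarrow> complete_system e I \<and>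
     (\<forall>n\<in>I. \<forall>m\<in>I. ip (e n) (e m) = (if n = m then 1 else 0))"

definition bounded_operator ::
  "((complex \<Rightarrow> complex) \<Rightarrow> (complex \<Rightarrow> complex)) \<Rightarrow> bool" where
  "bounded_operator U \<longleftrightarrow> U ` H \<subseteq> H \<and>
     (\<forall>f\<in>H. \<forall>g\<in>H. U (f + g) = U f + U g) \<and>
     (\<forall>c. \<forall>f\<in>H. U (cscale c f) = cscale c (U f)) \<and>
     (\<exists>C. \<forall>f\<in>H. hnorm (U f) \<le> C * hnorm f)"

definition bounded_invertible ::
  "((complex \<Rightarrow> complex) \<Rightarrow> (complex \<Rightarrow> complex)) \<Rightarrow> bool" where
  "bounded_invertible U \<longleftrightarrow> bounded_operator U \<and>
     (\<exists>V. bounded_operator V \<and> (\<forall>f\<in>H. V (U f) = f \<and> U (V f) = f))"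

definition riesz_basis :: "('i \<Rightarrow> complex \<Rightarrow> complex) \<Rightarrow> 'i set \<Rightarrow> bool" where
  "riesz_basis v I \<longleftrightarrow>
     (\<exists>e U. orthonormal_basis e I \<and> bounded_invertible U \<and> (\<forall>n\<in>I. v n = U (e n)))"

definition orth_complement :: "(complex \<Rightarrow> complex) set \<Rightarrow> (complex \<Rightarrow> complex) set" where
  "orth_complement S = {f \<in> H. \<forall>g\<in>S. ip f g = 0}"

definition normalize_vec :: "(complex \<Rightarrow> complex) \<Rightarrow> (complex \<Rightarrow> complex)" where
  "normalize_vec f = cscale (1 / of_real (hnorm f)) f"

end

definition finite_dim :: "(complex \<Rightarrow> complex) set \<Rightarrow> bool" where
  "finite_dim V \<longleftrightarrow> (\<exists>B. finite B \<and> V = cfun.span B)"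

text \<open>The entire function \<open>f z / (z - w)\<close> for an entire \<open>f\<close> with \<open>f w = 0\<close>; its value
  at the removable singularity \<open>w\<close> is \<open>f' w\<close>.\<close>

definition divide_zero :: "(complex \<Rightarrow> complex) \<Rightarrow> complex \<Rightarrow> (complex \<Rightarrow> complex)" where
  "divide_zero f w = (\<lambda>z. if z = w then deriv f w else f z / (z - w))"

text \<open>The class of spaces under consideration, together with the data \<open>k\<close> (reproducing
  kernels, which are determined by \<open>H\<close> and \<open>ip\<close>) and the infinite sequence \<open>t\<close>.\<close>

locale class_R = pre_hilbert H ip
  for H :: "(complex \<Rightarrow> complex) set"
    and ip :: "(complex \<Rightarrow> complex) \<Rightarrow> (complex \<Rightarrow> complex) \<Rightarrow> complex" +
  fixes k :: "complex \<Rightarrow> (complex \<Rightarrow> complex)"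
    and t :: "nat \<Rightarrow> complex"
  assumes hilbert: "mcomplete"
    and separable: "separable_space mtopology"
    and entire: "f \<in> H \<Longrightarrow> f holomorphic_on UNIV"
    and A1_mem: "k w \<in> H"
    and A1_reproducing: "f \<in> H \<Longrightarrow> ip f (k w) = f w"
    and A2: "\<lbrakk>f \<in> H; f w = 0\<rbrakk> \<Longrightarrow> divide_zero f w \<in> H"
    and A3_distinct: "inj t"
    and A3_riesz: "riesz_basis (\<lambda>n. normalize_vec (k (t n))) UNIV"
begin

definition generating_function :: "(complex \<Rightarrow> complex) \<Rightarrow> bool" where
  "generating_function F \<longleftrightarrow> F holomorphic_on UNIV \<and>
     biorthogonal (\<lambda>n. normalize_vec (k (t n)))
       (\<lambda>n. cscale (of_real (hnorm (k (t n))) / deriv F (t n)) (divide_zero F (t n))) UNIV"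

definition weight :: "(complex \<Rightarrow> complex) \<Rightarrow> nat \<Rightarrow> real" where
  "weight F n = (hnorm (k (t n)))\<^sup>2 / (cmod (deriv F (t n)))\<^sup>2"

end

end

theory Submission
  imports Defs
begin

text \<open>Let \<open>v\<^sub>l\<close> be biorthogonal to the kernels at \<open>\<Lambda>\<close>. An \<open>h\<close> orthogonal to all \<open>v\<^sub>l\<close> corresponds
  to an entire function \<open>S\<close>, known here only through its values \<open>\<sigma>\<^sub>n = S(t\<^sub>n)\<close>, with
  \<open>\<Sum> b\<^sub>n |\<sigma>\<^sub>n|\<^sup>2 < \<infinity>\<close> and \<open>\<Sum> \<sigma>\<^sub>n v\<^sub>l(t\<^sub>n) / F'(t\<^sub>n) = 0\<close> for every \<open>l\<close>. These sequences are stable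
  under \<open>S \<mapsto> (S - S(p)) / (z - p)\<close>. If \<open>|\<sigma>\<^sub>n| \<le> C / (1 + |t\<^sub>n|)\<close>, then \<open>(z - l) v\<^sub>l S\<close> lies in \<open>H\<close> and
  vanishes on \<open>\<Lambda>\<close>, so \<open>S = 0\<close>. The lower bound on the weights makes \<open>\<sigma>\<close> polynomially bounded in
  \<open>|t\<^sub>n|\<close>, so finitely many such steps lead to \<open>0\<close> and \<open>S\<close> is a polynomial of bounded degree. A
  nonzero polynomial is bounded away from \<open>0\<close> at almost all \<open>t\<^sub>n\<close>, which forces
  \<open>\<Sum> b\<^sub>n < \<infinity>\<close>.\<close>

subsection \<open>Square-summable sequences and inner product spaces\<close>

lemma l2_add_summable:
  fixes x y :: "nat \<Rightarrow> complex"
  assumes "summable (\<lambda>n. (cmod (x n))\<^sup>2)" "summable (\<lambda>n. (cmod (y n))\<^sup>2)"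
  shows "summable (\<lambda>n. (cmod (x n + y n))\<^sup>2)"
proof (rule summable_comparison_test')
  show "summable (\<lambda>n. 2 * (cmod (x n))\<^sup>2 + 2 * (cmod (y n))\<^sup>2)"
    using assms by (intro summable_add summable_mult)
  fix n
  have "(cmod (x n + y n))\<^sup>2 \<le> (cmod (x n) + cmod (y n))\<^sup>2"
    by (intro power_mono norm_triangle_ineq) simp
  moreover have "0 \<le> (cmod (x n) - cmod (y n))\<^sup>2" by simp
  ultimately show "norm ((cmod (x n + y n))\<^sup>2) \<le> 2 * (cmod (x n))\<^sup>2 + 2 * (cmod (y n))\<^sup>2"
    by (simp add: power2_sum power2_diff)
qed

lemma l2_mult_summable:
  fixes x y :: "nat \<Rightarrow> complex"
  assumes "summable (\<lambda>n. (cmod (x n))\<^sup>2)" "summable (\<lambda>n. (cmod (y n))\<^sup>2)"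
  shows "summable (\<lambda>n. x n * y n)"
proof (rule summable_comparison_test')
  show "summable (\<lambda>n. (cmod (x n))\<^sup>2 + (cmod (y n))\<^sup>2)"
    using assms by (rule summable_add)
  fix n
  have "0 \<le> (cmod (x n) - cmod (y n))\<^sup>2" by simp
  then have "2 * (cmod (x n) * cmod (y n)) \<le> (cmod (x n))\<^sup>2 + (cmod (y n))\<^sup>2"
    by (simp add: power2_diff)
  moreover have "0 \<le> cmod (x n) * cmod (y n)" by simp
  ultimately show "norm (x n * y n) \<le> (cmod (x n))\<^sup>2 + (cmod (y n))\<^sup>2"
    unfolding norm_mult by linarith
qed

lemma l2_bounded_mult:
  fixes x y :: "nat \<Rightarrow> complex"
  assumes x: "summable (\<lambda>n. (cmod (x n))\<^sup>2)" and le: "\<And>n. cmod (y n) \<le> C * cmod (x n)"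
  shows "summable (\<lambda>n. (cmod (y n))\<^sup>2)"
proof (rule summable_comparison_test')
  show "summable (\<lambda>n. C\<^sup>2 * (cmod (x n))\<^sup>2)"
    using x by (rule summable_mult)
  show "norm ((cmod (y n))\<^sup>2) \<le> C\<^sup>2 * (cmod (x n))\<^sup>2" for n
    using power_mono[OF le[of n], of 2] by (simp add: power_mult_distrib)
qed

section \<open>Inner product calculus, closed spans and orthonormal expansions\<close>

context pre_hilbert
begin

lemma ip_diff:
  assumes "f \<in> H" "g \<in> H" "h \<in> H"
  shows "ip (f - g) h = ip f h - ip g h"
  using ip_add[of "f - g" g h] assms by (simp add: diff_mem)

lemma ip_diff_right:
  assumes "f \<in> H" "g \<in> H" "h \<in> H"
  shows "ip h (f - g) = ip h f - ip h g"
  using ip_add_right[of "f - g" g h] assms by (simp add: diff_mem)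

lemma ip_zero: "h \<in> H \<Longrightarrow> ip 0 h = 0"
  using ip_diff[of h h h] by simp

lemma ip_zero_right: "h \<in> H \<Longrightarrow> ip h 0 = 0"
  using ip_diff_right[of h h h] by simp

lemma lincomb_mem: "(\<And>i. i \<in> A \<Longrightarrow> u i \<in> H) \<Longrightarrow> (\<Sum>i\<in>A. cscale (c i) (u i)) \<in> H"
  by (intro cfun.subspace_sum subspace_H scale_mem)

lemma ip_lincomb:
  assumes "finite A" "\<And>i. i \<in> A \<Longrightarrow> u i \<in> H" "h \<in> H"
  shows "ip (\<Sum>i\<in>A. cscale (c i) (u i)) h = (\<Sum>i\<in>A. c i * ip (u i) h)"
  using assms
  by (induction A rule: finite_induct) (simp_all add: ip_zero ip_add ip_scale scale_mem lincomb_mem)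

lemma ip_lincomb_right:
  assumes "finite A" "\<And>i. i \<in> A \<Longrightarrow> u i \<in> H" "h \<in> H"
  shows "ip h (\<Sum>i\<in>A. cscale (c i) (u i)) = (\<Sum>i\<in>A. cnj (c i) * ip h (u i))"
  using assms
  by (induction A rule: finite_induct)
     (simp_all add: ip_zero_right ip_add_right ip_scale_right scale_mem lincomb_mem)

lemma hnorm_square: "f \<in> H \<Longrightarrow> (hnorm f)\<^sup>2 = Re (ip f f)"
  by (simp add: ip_self)

lemma hnorm_zero: "hnorm 0 = 0"
  using hnorm_eq_0[OF zero_mem] by simp

lemma hnorm_diff_commute:
  assumes "f \<in> H" "g \<in> H"
  shows "hnorm (f - g) = hnorm (g - f)"
  using commute[of f g] assms by (simp add: hdist_def)

lemma ip_tendsto: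
  assumes u: "\<And>n. u n \<in> H" and f: "f \<in> H" and h: "h \<in> H"
    and lim: "(\<lambda>n. hnorm (u n - f)) \<longlonglongrightarrow> 0"
  shows "(\<lambda>n. ip (u n) h) \<longlonglongrightarrow> ip f h"
proof -
  have "(\<lambda>n. ip (u n) h - ip f h) \<longlonglongrightarrow> 0"
  proof (rule Lim_null_comparison)
    show "\<forall>\<^sub>F n in sequentially. cmod (ip (u n) h - ip f h) \<le> hnorm (u n - f) * hnorm h"
      using Cauchy_Schwarz[OF diff_mem[OF u f] h] by (simp add: ip_diff u f h)
    show "(\<lambda>n. hnorm (u n - f) * hnorm h) \<longlonglongrightarrow> 0"
      using tendsto_mult_left_zero[OF lim] .
  qed
  then show ?thesis by (rule LIM_zero_cancel)
qed

lemma hnorm_Cauchy_convergent: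
  assumes mc: mcomplete and u: "\<And>n. u n \<in> H"
    and cau: "\<And>\<epsilon>. \<epsilon> > 0 \<Longrightarrow> \<exists>N. \<forall>m\<ge>N. \<forall>n\<ge>N. hnorm (u m - u n) < \<epsilon>"
  obtains f where "f \<in> H" "(\<lambda>n. hnorm (u n - f)) \<longlonglongrightarrow> 0"
proof -
  have "MCauchy u"
    unfolding MCauchy_def using u cau by (auto simp: hdist_def)
  then obtain f where "limitin mtopology u f sequentially"
    using mc unfolding mcomplete_def by blast
  then have f: "f \<in> H" and "\<And>\<epsilon>. \<epsilon> > 0 \<Longrightarrow> \<exists>N. \<forall>n\<ge>N. hdist (u n) f < \<epsilon>"
    unfolding limit_metric_sequentially by metis+
  then have "(\<lambda>n. hnorm (u n - f)) \<longlonglongrightarrow> 0"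
    by (auto simp: LIMSEQ_iff hdist_def u diff_mem hnorm_nonneg)
  with f that show thesis by blast
qed

lemma span_subset_H: "S \<subseteq> H \<Longrightarrow> cfun.span S \<subseteq> H"
  by (rule cfun.span_minimal[OF _ subspace_H])

lemma complete_system_approx:
  assumes "complete_system v I" "g \<in> H" "\<epsilon> > 0"
  obtains s where "s \<in> cfun.span (v ` I)" "hnorm (g - s) < \<epsilon>"
proof -
  have "g \<in> mtopology closure_of cfun.span (v ` I)" and sub: "v ` I \<subseteq> H"
    using assms by (auto simp: complete_system_def)
  then obtain s where "s \<in> cfun.span (v ` I)" "s \<in> mball g \<epsilon>"
    using assms(3) unfolding metric_closure_of by blast
  then show thesis
    using that by (auto simp: hdist_def)
qed

text \<open>If \<open>f \<noteq> 0\<close>, completeness yields \<open>s\<close> in the span with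
  \<open>hnorm (f - s) < hnorm f\<close>; but \<open>f\<close> is orthogonal to \<open>s\<close>, so
  Cauchy-Schwarz for \<open>ip f (f - s)\<close> gives the opposite inequality.\<close>

lemma complete_system_orthogonal:
  assumes cs: "complete_system v I" and f: "f \<in> H" and orth: "\<And>i. i \<in> I \<Longrightarrow> ip f (v i) = 0"
  shows "f = 0"
proof (rule ccontr)
  assume "f \<noteq> 0"
  then have pos: "hnorm f > 0" using hnorm_eq_0[OF f] hnorm_nonneg[OF f] by simp
  have vH: "v ` I \<subseteq> H" using cs by (simp add: complete_system_def)
  obtain s where s: "s \<in> cfun.span (v ` I)" "hnorm (f - s) < hnorm f"
    using complete_system_approx[OF cs f pos] .
  have sub: "cfun.subspace {g \<in> H. ip f g = 0}"
    using f by (auto simp: cfun.subspace_def zero_mem add_mem scale_mem ip_zero_right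
        ip_add_right ip_scale_right)
  have "s \<in> {g \<in> H. ip f g = 0}"
    using cfun.span_minimal[OF _ sub, of "v ` I"] s(1) vH orth by blast
  then have sH: "s \<in> H" and fs: "ip f s = 0" by auto
  have "ip f f = ip f (f - s)" by (simp add: ip_diff_right f sH fs)
  then have "(hnorm f)\<^sup>2 \<le> hnorm f * hnorm (f - s)"
    using Cauchy_Schwarz[OF f diff_mem[OF f sH]] ip_self[OF f]
    by (metis norm_of_real abs_of_nonneg zero_le_power2)
  then show False using pos s(2) by (simp add: power2_eq_square)
qed

lemma hnorm_orthonormal_lincomb:
  assumes "finite A" and e: "\<And>i. i \<in> A \<Longrightarrow> e i \<in> H"
    and on: "\<And>i j. i \<in> A \<Longrightarrow> j \<in> A \<Longrightarrow> ip (e i) (e j) = (if i = j then 1 else 0)"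
  shows "(hnorm (\<Sum>i\<in>A. cscale (c i) (e i)))\<^sup>2 = (\<Sum>i\<in>A. (cmod (c i))\<^sup>2)"
proof -
  let ?s = "\<Sum>i\<in>A. cscale (c i) (e i)"
  have s: "?s \<in> H" using e by (rule lincomb_mem)
  have "ip ?s ?s = (\<Sum>i\<in>A. c i * ip (e i) ?s)"
    using assms(1) e s by (rule ip_lincomb)
  also have "\<dots> = (\<Sum>i\<in>A. c i * cnj (c i))"
  proof (rule sum.cong[OF refl])
    fix i assume i: "i \<in> A"
    have "ip (e i) ?s = (\<Sum>j\<in>A. cnj (c j) * ip (e i) (e j))"
      using assms(1) e e[OF i] by (rule ip_lincomb_right)
    also have "\<dots> = (\<Sum>j\<in>A. if j = i then cnj (c j) else 0)"
      using on i by (intro sum.cong) auto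
    finally show "c i * ip (e i) ?s = c i * cnj (c i)"
      using assms(1) i by simp
  qed
  also have "\<dots> = of_real (\<Sum>i\<in>A. (cmod (c i))\<^sup>2)"
    by (simp only: complex_norm_square[symmetric] of_real_sum)
  finally show ?thesis
    unfolding hnorm_square[OF s] by simp
qed

text \<open>Pythagoras: \<open>g - P\<close> is orthogonal to every combination of the first
  \<open>n\<close> vectors, hence to \<open>P - s\<close>. A general \<open>s\<close> yields best
  approximation by \<open>P\<close>, and \<open>s = 0\<close> yields Bessel's inequality.\<close>

lemma orthonormal_residual:
  assumes e: "\<And>i. e i \<in> H"
    and on: "\<And>i j. ip (e i) (e j) = (if i = j then 1 else 0)" and g: "g \<in> H"
    and P: "P = (\<Sum>i<(n::nat). cscale (ip g (e i)) (e i))" and s: "s = (\<Sum>i<n. cscale (c i) (e i))"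
  shows "(hnorm (g - s))\<^sup>2 = (hnorm (g - P))\<^sup>2 + (hnorm (P - s))\<^sup>2"
proof -
  have PH: "P \<in> H" unfolding P by (rule lincomb_mem) (rule e)
  have sH: "s \<in> H" unfolding s by (rule lincomb_mem) (rule e)
  have "ip (g - P) (e j) = 0" if "j < n" for j
  proof -
    have "ip P (e j) = (\<Sum>i<n. ip g (e i) * ip (e i) (e j))"
      unfolding P using e by (intro ip_lincomb) auto
    also have "\<dots> = (\<Sum>i<n. if i = j then ip g (e i) else 0)"
      by (intro sum.cong) (auto simp: on)
    finally show ?thesis using that g PH e by (simp add: ip_diff)
  qed
  then have 0: "ip (g - P) (\<Sum>i<n. cscale (d i) (e i)) = 0" for d
    using ip_lincomb_right[of "{..<n}" e "g - P" d] e diff_mem[OF g PH] by simp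
  have "ip (g - P) P = 0" "ip (g - P) s = 0"
    using 0[of "\<lambda>i. ip g (e i)"] 0[of c] by (simp_all add: P[symmetric] s[symmetric])
  then have o: "ip (g - P) (P - s) = 0"
    using diff_mem[OF g PH] PH sH by (simp add: ip_diff_right)
  then have o': "ip (P - s) (g - P) = 0"
    using ip_cnj[OF diff_mem[OF g PH] diff_mem[OF PH sH]] by simp
  have "g - s = (g - P) + (P - s)" by simp
  then have "ip (g - s) (g - s) = ip ((g - P) + (P - s)) ((g - P) + (P - s))" by simp
  also have "\<dots> = ip (g - P) (g - P) + ip (P - s) (P - s)"
    using diff_mem[OF g PH] diff_mem[OF PH sH]
    by (simp only: ip_add ip_add_right add_mem o o') simp
  finally show ?thesis
    using diff_mem[OF g PH] diff_mem[OF PH sH] diff_mem[OF g sH] by (simp add: hnorm_square)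
qed

text \<open>A sum over an initial segment is convenient because it can be lengthened by zero
  coefficients.\<close>

lemma span_range_lincomb:
  assumes "s \<in> cfun.span (range (e :: nat \<Rightarrow> _))"
  obtains N c where "s = (\<Sum>i<N. cscale (c i) (e i))"
proof -
  have "\<exists>N c. s = (\<Sum>i<N. cscale (c i) (e i))"
    using assms
  proof (induction rule: cfun.span_induct_alt)
    case base
    show ?case
      by (intro exI[of _ 0] exI[of _ "\<lambda>_. 0"]) (simp only: lessThan_0 sum.empty)
  next
    case (step a x y)
    then obtain N c m where y: "y = (\<Sum>i<N. cscale (c i) (e i))" and x: "x = e m" by blast
    \<comment> \<open>The new coefficient is added, not substituted, since \<open>e m\<close> may
      already occur in \<open>y\<close>.\<close>
    let ?c = "\<lambda>i. (if i < N then c i else 0) + (if i = m then a else 0)"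
    have "(\<Sum>i<max N (Suc m). cscale (?c i) (e i)) =
        (\<Sum>i<max N (Suc m). cscale (if i < N then c i else 0) (e i)) +
        (\<Sum>i<max N (Suc m). cscale (if i = m then a else 0) (e i))"
      by (simp only: cfun.scale_left_distrib sum.distrib)
    also have "(\<Sum>i<max N (Suc m). cscale (if i = m then a else 0) (e i)) =
        (\<Sum>i<max N (Suc m). if i = m then cscale a (e i) else 0)"
      by (intro sum.cong) auto
    also have "\<dots> = cscale a x" by (simp add: x)
    also have "(\<Sum>i<max N (Suc m). cscale (if i < N then c i else 0) (e i)) = y"
      unfolding y by (rule sum.mono_neutral_cong_right) auto
    finally have "cscale a x + y = (\<Sum>i<max N (Suc m). cscale (?c i) (e i))"
      by (simp only: add.commute)
    then show ?case by (intro exI)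
  qed
  with that show thesis by blast
qed

text \<open>Density gives a finite combination \<open>s\<close> within \<open>r\<close> of
  \<open>g\<close>. Every partial sum at least as long as \<open>s\<close> is no farther from
  \<open>g\<close>, by \<open>orthonormal_residual\<close>.\<close>

lemma orthonormal_basis_expansion:
  assumes onb: "orthonormal_basis e (UNIV :: nat set)" and g: "g \<in> H"
  shows "(\<lambda>n. hnorm ((\<Sum>i<n. cscale (ip g (e i)) (e i)) - g)) \<longlonglongrightarrow> 0"
proof (rule LIMSEQ_I)
  fix r :: real assume r: "r > 0"
  have cs: "complete_system e UNIV" and on: "\<And>i j. ip (e i) (e j) = (if i = j then 1 else 0)"
    using onb by (auto simp: orthonormal_basis_def)
  have e: "e i \<in> H" for i using cs by (auto simp: complete_system_def)
  let ?P = "\<lambda>n. \<Sum>i<n. cscale (ip g (e i)) (e i)"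
  obtain s where "s \<in> cfun.span (range e)" and sr: "hnorm (g - s) < r"
    using complete_system_approx[OF cs g r] .
  then obtain N c where s: "s = (\<Sum>i<N. cscale (c i) (e i))"
    using span_range_lincomb by blast
  have "hnorm (g - ?P n) < r" if n: "n \<ge> N" for n
  proof -
    let ?d = "\<lambda>i. if i < N then c i else 0"
    have s': "s = (\<Sum>i<n. cscale (?d i) (e i))"
      unfolding s using n by (intro sum.mono_neutral_cong_left) auto
    have sH: "s \<in> H" unfolding s using e by (intro lincomb_mem)
    have PH: "?P n \<in> H" using e by (intro lincomb_mem)
    have "(hnorm (g - s))\<^sup>2 = (hnorm (g - ?P n))\<^sup>2 + (hnorm (?P n - s))\<^sup>2"
      by (rule orthonormal_residual[OF e on g refl s'])
    then have "(hnorm (g - ?P n))\<^sup>2 \<le> (hnorm (g - s))\<^sup>2" by simp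
    then have "hnorm (g - ?P n) \<le> hnorm (g - s)"
      by (rule power2_le_imp_le) (simp add: hnorm_nonneg diff_mem g sH)
    with sr show ?thesis by simp
  qed
  moreover have "?P n \<in> H" for n using e by (intro lincomb_mem)
  ultimately show "\<exists>N. \<forall>n\<ge>N. norm (hnorm (?P n - g) - 0) < r"
    using hnorm_diff_commute[of g "?P _"] g by (auto simp: hnorm_nonneg diff_mem)
qed

lemma bessel:
  assumes onb: "orthonormal_basis e (UNIV :: nat set)" and g: "g \<in> H"
  shows "(\<Sum>i<n. (cmod (ip g (e i)))\<^sup>2) \<le> (hnorm g)\<^sup>2"
proof -
  have on: "\<And>i j. ip (e i) (e j) = (if i = j then 1 else 0)" and e: "\<And>i. e i \<in> H"
    using onb by (auto simp: orthonormal_basis_def complete_system_def)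
  let ?P = "\<Sum>i<n. cscale (ip g (e i)) (e i)"
  have "0 = (\<Sum>i<n. cscale 0 (e i))" by simp
  then have "(hnorm (g - 0))\<^sup>2 = (hnorm (g - ?P))\<^sup>2 + (hnorm (?P - 0))\<^sup>2"
    using orthonormal_residual[OF e on g refl, of 0 "\<lambda>_. 0" n] by blast
  moreover have "(hnorm ?P)\<^sup>2 = (\<Sum>i<n. (cmod (ip g (e i)))\<^sup>2)"
    using hnorm_orthonormal_lincomb[of "{..<n}" e "\<lambda>i. ip g (e i)"] e on by blast
  ultimately show ?thesis by simp
qed

lemma bounded_operator_lincomb:
  assumes U: "bounded_operator U" and "finite A" and "\<And>i. i \<in> A \<Longrightarrow> u i \<in> H"
  shows "U (\<Sum>i\<in>A. cscale (c i) (u i)) = (\<Sum>i\<in>A. cscale (c i) (U (u i)))"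
  using assms(2,3)
proof (induction A rule: finite_induct)
  case empty
  have "U (cscale 0 0) = cscale 0 (U 0)"
    using U zero_mem unfolding bounded_operator_def by blast
  then show ?case by (simp only: sum.empty cfun.scale_zero_left)
next
  case (insert x F)
  have "U (cscale (c x) (u x) + (\<Sum>i\<in>F. cscale (c i) (u i))) =
      U (cscale (c x) (u x)) + U (\<Sum>i\<in>F. cscale (c i) (u i))"
    using U insert.prems unfolding bounded_operator_def by (simp add: scale_mem lincomb_mem)
  moreover have "U (cscale (c x) (u x)) = cscale (c x) (U (u x))"
    using U insert.prems unfolding bounded_operator_def by simp
  moreover have "U (\<Sum>i\<in>F. cscale (c i) (u i)) = (\<Sum>i\<in>F. cscale (c i) (U (u i)))"
    using insert by blast
  ultimately show ?case
    by (simp only: sum.insert[OF insert.hyps])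
qed

lemma bounded_operator_bound:
  assumes "bounded_operator U"
  obtains C where "C \<ge> 0" "\<And>f. f \<in> H \<Longrightarrow> hnorm (U f) \<le> C * hnorm f"
proof -
  obtain C where C: "\<And>f. f \<in> H \<Longrightarrow> hnorm (U f) \<le> C * hnorm f"
    using assms unfolding bounded_operator_def by blast
  have "hnorm (U f) \<le> \<bar>C\<bar> * hnorm f" if "f \<in> H" for f
    using C[OF that] mult_right_mono[OF abs_ge_self[of C] hnorm_nonneg[OF that]] by linarith
  then show thesis using that[of "\<bar>C\<bar>"] by simp
qed

end

section \<open>Riesz bases: expansion, Parseval identity and Riesz-Fischer theorem\<close>

locale riesz_pair = pre_hilbert H ip
  for H :: "(complex \<Rightarrow> complex) set"
    and ip :: "(complex \<Rightarrow> complex) \<Rightarrow> (complex \<Rightarrow> complex) \<Rightarrow> complex" +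
  fixes v w :: "nat \<Rightarrow> complex \<Rightarrow> complex"
  assumes hilbert_space: mcomplete
    and riesz: "riesz_basis v UNIV"
    and biorth: "biorthogonal v w UNIV"
begin

lemma v_mem: "v n \<in> H" and w_mem: "w n \<in> H"
  and ip_v_w: "ip (v n) (w m) = (if n = m then 1 else 0)"
  using biorth by (auto simp: biorthogonal_def)

lemma ip_w_v: "ip (w m) (v n) = (if n = m then 1 else 0)"
  using ip_cnj[OF v_mem[of n] w_mem[of m]] by (simp add: ip_v_w)

text \<open>Everything is transported from the orthonormal basis \<open>e\<close> with
  \<open>v n = U (e n)\<close>: \<open>U\<close> maps the expansion of \<open>V h\<close> to that of
  \<open>h\<close>, and the coefficients of \<open>h\<close> are those of \<open>V h\<close>, so
  Bessel applies. The last bound is obtained by duality.\<close>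

lemma expansion_and_bound:
  obtains C where "C \<ge> 0"
    "\<And>h. h \<in> H \<Longrightarrow> (\<lambda>n. hnorm ((\<Sum>i<n. cscale (ip h (w i)) (v i)) - h)) \<longlonglongrightarrow> 0"
    "\<And>h n. h \<in> H \<Longrightarrow> (\<Sum>i<n. (cmod (ip (w i) h))\<^sup>2) \<le> (C * hnorm h)\<^sup>2"
    "\<And>f n. f \<in> H \<Longrightarrow> (\<Sum>i<n. (cmod (ip f (v i)))\<^sup>2) \<le> (C * hnorm f)\<^sup>2"
proof -
  obtain e U V where onb: "orthonormal_basis e (UNIV :: nat set)" and U: "bounded_operator U"
    and V: "bounded_operator V" and UV: "\<And>f. f \<in> H \<Longrightarrow> U (V f) = f"
    and v: "\<And>n. v n = U (e n)"
    using riesz unfolding riesz_basis_def bounded_invertible_def by blast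
  have on: "\<And>i j. ip (e i) (e j) = (if i = j then 1 else 0)" and e: "\<And>i. e i \<in> H"
    using onb by (auto simp: orthonormal_basis_def complete_system_def)
  have UH: "f \<in> H \<Longrightarrow> U f \<in> H" and VH: "f \<in> H \<Longrightarrow> V f \<in> H" for f
    using U V by (auto simp: bounded_operator_def)
  obtain C1 where C1: "C1 \<ge> 0" "\<And>f. f \<in> H \<Longrightarrow> hnorm (U f) \<le> C1 * hnorm f"
    by (rule bounded_operator_bound[OF U]) blast
  obtain C2 where C2: "C2 \<ge> 0" "\<And>f. f \<in> H \<Longrightarrow> hnorm (V f) \<le> C2 * hnorm f"
    by (rule bounded_operator_bound[OF V]) blast
  have conv: "(\<lambda>n. hnorm ((\<Sum>i<n. cscale (ip (V h) (e i)) (v i)) - h)) \<longlonglongrightarrow> 0" if h: "h \<in> H" for h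
  proof (rule Lim_null_comparison)
    let ?P = "\<lambda>n. \<Sum>i<n. cscale (ip (V h) (e i)) (e i)"
    have PH: "?P n \<in> H" for n using e by (intro lincomb_mem)
    have "hnorm ((\<Sum>i<n. cscale (ip (V h) (e i)) (v i)) - h) \<le> C1 * hnorm (?P n - V h)" for n
    proof -
      have d: "U (?P n - V h) = U (?P n) - h"
      proof -
        have "U ((?P n - V h) + V h) = U (?P n - V h) + U (V h)"
          using U PH[of n] VH[OF h] diff_mem[OF PH[of n] VH[OF h]]
          unfolding bounded_operator_def by blast
        then show ?thesis by (simp add: UV[OF h])
      qed
      have "U (?P n) = (\<Sum>i<n. cscale (ip (V h) (e i)) (v i))"
        using bounded_operator_lincomb[OF U, of "{..<n}" e "\<lambda>i. ip (V h) (e i)"] e v by simp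
      then show ?thesis using C1(2)[OF diff_mem[OF PH[of n] VH[OF h]]] d by simp
    qed
    moreover have "0 \<le> hnorm ((\<Sum>i<n. cscale (ip (V h) (e i)) (v i)) - h)" for n
      using v_mem h by (intro hnorm_nonneg diff_mem lincomb_mem)
    ultimately show "\<forall>\<^sub>F n in sequentially.
        norm (hnorm ((\<Sum>i<n. cscale (ip (V h) (e i)) (v i)) - h)) \<le> C1 * hnorm (?P n - V h)"
      by simp
    show "(\<lambda>n. C1 * hnorm (?P n - V h)) \<longlonglongrightarrow> 0"
      using tendsto_mult_right_zero[OF orthonormal_basis_expansion[OF onb VH[OF h]]] .
  qed
  \<comment> \<open>By biorthogonality the inner products of the partial sums with
    \<open>w m\<close> are eventually constant; continuity identifies that constant with
    \<open>ip h (w m)\<close>.\<close>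
  have coeff: "ip (V h) (e m) = ip h (w m)" if h: "h \<in> H" for h m
  proof -
    let ?s = "\<lambda>n. \<Sum>i<n. cscale (ip (V h) (e i)) (v i)"
    have "ip (?s n) (w m) = ip (V h) (e m)" if "n > m" for n
    proof -
      have "ip (?s n) (w m) = (\<Sum>i<n. ip (V h) (e i) * ip (v i) (w m))"
        using v_mem w_mem by (intro ip_lincomb) auto
      also have "\<dots> = (\<Sum>i<n. if i = m then ip (V h) (e i) else 0)"
        by (intro sum.cong) (auto simp: ip_v_w)
      finally show ?thesis using that by simp
    qed
    then have "(\<lambda>n. ip (?s n) (w m)) \<longlonglongrightarrow> ip (V h) (e m)"
      by (intro tendsto_eventually eventually_at_top_dense[THEN iffD2]) auto
    moreover have "(\<lambda>n. ip (?s n) (w m)) \<longlonglongrightarrow> ip h (w m)"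
      using v_mem by (intro ip_tendsto lincomb_mem h w_mem conv)
    ultimately show ?thesis by (rule LIMSEQ_unique)
  qed
  define C where "C = max C1 C2"
  have "C \<ge> 0" using C1 by (simp add: C_def)
  moreover have "(\<lambda>n. hnorm ((\<Sum>i<n. cscale (ip h (w i)) (v i)) - h)) \<longlonglongrightarrow> 0" if h: "h \<in> H" for h
    using conv[OF h] coeff[OF h] by simp
  moreover have "(\<Sum>i<n. (cmod (ip (w i) h))\<^sup>2) \<le> (C * hnorm h)\<^sup>2" if h: "h \<in> H" for h n
  proof -
    have "cmod (ip (w i) h) = cmod (ip (V h) (e i))" for i
      using ip_cnj[OF h w_mem[of i]] coeff[OF h] by simp
    then have "(\<Sum>i<n. (cmod (ip (w i) h))\<^sup>2) \<le> (hnorm (V h))\<^sup>2"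
      using bessel[OF onb VH[OF h], of n] by simp
    also have "\<dots> \<le> (C * hnorm h)\<^sup>2"
    proof (rule power_mono)
      show "hnorm (V h) \<le> C * hnorm h"
        using C2(2)[OF h] mult_right_mono[of C2 C "hnorm h"] hnorm_nonneg[OF h]
        by (simp add: C_def)
      show "0 \<le> hnorm (V h)" using VH[OF h] by (rule hnorm_nonneg)
    qed
    finally show ?thesis .
  qed
  moreover have "(\<Sum>i<n. (cmod (ip f (v i)))\<^sup>2) \<le> (C * hnorm f)\<^sup>2" if f: "f \<in> H" for f n
  proof -
    \<comment> \<open>Testing \<open>f\<close> against \<open>U ?s\<close> replaces an adjoint of
      \<open>U\<close>: it gives \<open>(hnorm ?s)\<^sup>2 \<le> C * hnorm f * hnorm ?s\<close>, and
      one factor \<open>hnorm ?s\<close> cancels.\<close>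
    let ?c = "\<lambda>i. ip f (v i)"
    let ?s = "\<Sum>i<n. cscale (?c i) (e i)"
    define X where "X = (\<Sum>i<n. (cmod (?c i))\<^sup>2)"
    have X0: "X \<ge> 0" unfolding X_def by (intro sum_nonneg) simp
    have sH: "?s \<in> H" using e by (intro lincomb_mem)
    have s2: "(hnorm ?s)\<^sup>2 = X"
      unfolding X_def using e on by (intro hnorm_orthonormal_lincomb) auto
    have "U ?s = (\<Sum>i<n. cscale (?c i) (v i))"
      using bounded_operator_lincomb[OF U, of "{..<n}" e ?c] e v by simp
    then have "ip f (U ?s) = (\<Sum>i<n. cnj (?c i) * ip f (v i))"
      using ip_lincomb_right[of "{..<n}" v f ?c] v_mem f by simp
    also have "\<dots> = (\<Sum>i<n. of_real ((cmod (?c i))\<^sup>2))"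
      by (intro sum.cong refl) (metis complex_norm_square mult.commute)
    also have "\<dots> = of_real X" by (simp add: X_def)
    finally have "X = cmod (ip f (U ?s))" using X0 by simp
    also have "\<dots> \<le> hnorm f * hnorm (U ?s)" using f UH[OF sH] by (rule Cauchy_Schwarz)
    also have "\<dots> \<le> hnorm f * (C * hnorm ?s)"
    proof (rule mult_left_mono)
      show "hnorm (U ?s) \<le> C * hnorm ?s"
        using C1(2)[OF sH] mult_right_mono[of C1 C "hnorm ?s"] hnorm_nonneg[OF sH]
        by (simp add: C_def)
    qed (use f in \<open>rule hnorm_nonneg\<close>)
    finally have "(hnorm ?s)\<^sup>2 \<le> (C * hnorm f) * hnorm ?s"
      using s2 by (simp add: mult_ac)
    then have "hnorm ?s \<le> C * hnorm f"
      using hnorm_nonneg[OF sH] hnorm_nonneg[OF f] \<open>C \<ge> 0\<close>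
      by (cases "hnorm ?s = 0") (auto simp: power2_eq_square)
    then show ?thesis
      using power_mono[of "hnorm ?s" "C * hnorm f" 2] hnorm_nonneg[OF sH] s2 X_def by simp
  qed
  ultimately show thesis using that by blast
qed

lemma summable_square_ip_w:
  assumes "h \<in> H" shows "summable (\<lambda>n. (cmod (ip (w n) h))\<^sup>2)"
proof -
  obtain C where C: "\<And>h n. h \<in> H \<Longrightarrow> (\<Sum>i<n. (cmod (ip (w i) h))\<^sup>2) \<le> (C * hnorm h)\<^sup>2"
    by (rule expansion_and_bound) blast
  show ?thesis by (rule summableI_nonneg_bounded[OF _ C[OF assms]]) simp
qed

lemma summable_square_ip_v:
  assumes "f \<in> H" shows "summable (\<lambda>n. (cmod (ip f (v n)))\<^sup>2)"
proof -
  obtain C where C: "\<And>h n. h \<in> H \<Longrightarrow> (\<Sum>i<n. (cmod (ip h (v i)))\<^sup>2) \<le> (C * hnorm h)\<^sup>2"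
    by (rule expansion_and_bound) blast
  show ?thesis by (rule summableI_nonneg_bounded[OF _ C[OF assms]]) simp
qed

text \<open>The expansion of \<open>h\<close> in \<open>v\<close> is paired with \<open>f\<close>.
  The limit is taken in the first argument, giving \<open>ip h f\<close>, and then
  conjugated.\<close>

lemma parseval:
  assumes f: "f \<in> H" and h: "h \<in> H"
  shows "(\<lambda>n. ip f (v n) * ip (w n) h) sums ip f h"
proof -
  have "(\<lambda>n. hnorm ((\<Sum>i<n. cscale (ip h (w i)) (v i)) - h)) \<longlonglongrightarrow> 0"
    by (rule expansion_and_bound) (use h in blast)
  then have "(\<lambda>n. ip (\<Sum>i<n. cscale (ip h (w i)) (v i)) f) \<longlonglongrightarrow> ip h f"
    using v_mem by (intro ip_tendsto lincomb_mem f h)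
  then have "(\<lambda>n. cnj (ip (\<Sum>i<n. cscale (ip h (w i)) (v i)) f)) \<longlonglongrightarrow> cnj (ip h f)"
    by (rule tendsto_cnj)
  moreover have "cnj (ip (\<Sum>i<n. cscale (ip h (w i)) (v i)) f) =
      (\<Sum>i<n. ip f (v i) * ip (w i) h)" for n
    using v_mem f ip_cnj[OF v_mem f] ip_cnj[OF h w_mem]
    by (simp add: ip_lincomb mult.commute)
  ultimately show ?thesis using ip_cnj[OF h f] by (simp add: sums_def)
qed

text \<open>The solution is the series of the \<open>x n\<close> times \<open>w n\<close>. The bound
  on the coefficients \<open>ip (w i) h\<close> dualizes to a bound on norms of finite combinations
  of the \<open>w i\<close>, so the partial sums are Cauchy.\<close>

lemma riesz_fischer:
  assumes x: "summable (\<lambda>n. (cmod (x n))\<^sup>2)"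
  obtains f where "f \<in> H" "\<And>n. ip f (v n) = x n"
proof -
  obtain C where C0: "C \<ge> 0"
    and C: "\<And>h n. h \<in> H \<Longrightarrow> (\<Sum>i<n. (cmod (ip (w i) h))\<^sup>2) \<le> (C * hnorm h)\<^sup>2"
    by (rule expansion_and_bound) blast
  define u where "u n = (\<Sum>i<n. cscale (x i) (w i))" for n
  have uH: "u n \<in> H" for n unfolding u_def using w_mem by (intro lincomb_mem)
  have diff: "hnorm (u n - u m) \<le> C * sqrt (\<Sum>i=m..<n. (cmod (x i))\<^sup>2)" if mn: "m \<le> n" for m n
  proof -
    let ?d = "u n - u m"
    have dH: "?d \<in> H" using uH by (intro diff_mem)
    have d: "?d = (\<Sum>i=m..<n. cscale (x i) (w i))"
      unfolding u_def using sum_diff[of "{..<n}" "{..<m}" "\<lambda>i. cscale (x i) (w i)"] mn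
      by (simp add: lessThan_minus_lessThan)
    have "ip ?d ?d = (\<Sum>i=m..<n. x i * ip (w i) ?d)"
      using ip_lincomb[of "{m..<n}" w ?d x] w_mem dH unfolding d[symmetric] by simp
    then have "(hnorm ?d)\<^sup>2 = cmod (\<Sum>i=m..<n. x i * ip (w i) ?d)"
      using ip_self[OF dH] by (metis norm_of_real abs_of_nonneg zero_le_power2)
    also have "\<dots> \<le> (\<Sum>i=m..<n. \<bar>cmod (x i)\<bar> * \<bar>cmod (ip (w i) ?d)\<bar>)"
      by (rule order_trans[OF norm_sum]) (simp add: norm_mult)
    also have "\<dots> \<le> L2_set (\<lambda>i. cmod (x i)) {m..<n} * L2_set (\<lambda>i. cmod (ip (w i) ?d)) {m..<n}"
      by (rule L2_set_mult_ineq)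
    also have "\<dots> \<le> sqrt (\<Sum>i=m..<n. (cmod (x i))\<^sup>2) * (C * hnorm ?d)"
    proof (unfold L2_set_def, rule mult_left_mono)
      have "(\<Sum>i=m..<n. (cmod (ip (w i) ?d))\<^sup>2) \<le> (\<Sum>i<n. (cmod (ip (w i) ?d))\<^sup>2)"
        by (intro sum_mono2) auto
      also have "\<dots> \<le> (C * hnorm ?d)\<^sup>2" using C[OF dH] .
      finally show "sqrt (\<Sum>i=m..<n. (cmod (ip (w i) ?d))\<^sup>2) \<le> C * hnorm ?d"
        using C0 hnorm_nonneg[OF dH] by (intro real_le_lsqrt) auto
    qed (simp add: sum_nonneg)
    finally have "hnorm ?d * hnorm ?d \<le> (C * sqrt (\<Sum>i=m..<n. (cmod (x i))\<^sup>2)) * hnorm ?d"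
      by (simp add: power2_eq_square mult_ac)
    then show ?thesis
      using hnorm_nonneg[OF dH] C0 by (cases "hnorm ?d = 0") (auto simp: sum_nonneg)
  qed
  have cau: "\<exists>N. \<forall>m\<ge>N. \<forall>n\<ge>N. hnorm (u m - u n) < \<epsilon>" if \<epsilon>: "\<epsilon> > 0" for \<epsilon>
  proof -
    \<comment> \<open>Dividing by \<open>C + 1\<close> covers \<open>C = 0\<close> and makes the
      final estimate strict.\<close>
    define \<delta> where "\<delta> = (\<epsilon> / (C + 1))\<^sup>2"
    have "\<delta> > 0" using \<epsilon> C0 by (simp add: \<delta>_def)
    then obtain N where N: "\<And>m n. m \<ge> N \<Longrightarrow> norm (\<Sum>i=m..<n. (cmod (x i))\<^sup>2) < \<delta>"
      using x unfolding summable_Cauchy by blast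
    have small: "hnorm (u n - u m) < \<epsilon>" if "N \<le> m" "m \<le> n" for m n
    proof -
      have "sqrt (\<Sum>i=m..<n. (cmod (x i))\<^sup>2) \<le> sqrt \<delta>"
        using N[OF that(1), of n] by simp
      also have "\<dots> = \<epsilon> / (C + 1)" using \<epsilon> C0 by (simp add: \<delta>_def)
      finally have "C * sqrt (\<Sum>i=m..<n. (cmod (x i))\<^sup>2) \<le> C * (\<epsilon> / (C + 1))"
        using C0 by (rule mult_left_mono)
      also have "\<dots> < \<epsilon>" using \<epsilon> C0 by (simp add: field_simps)
      finally show ?thesis using diff[OF that(2)] by linarith
    qed
    show ?thesis
    proof (intro exI allI impI)
      fix m n assume "m \<ge> N" "n \<ge> N"
      then show "hnorm (u m - u n) < \<epsilon>"
        using small[of m n] small[of n m] hnorm_diff_commute[OF uH[of m] uH[of n]]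
        by (cases "m \<le> n") auto
    qed
  qed
  obtain f where f: "f \<in> H" and lim: "(\<lambda>n. hnorm (u n - f)) \<longlonglongrightarrow> 0"
    by (rule hnorm_Cauchy_convergent[OF hilbert_space, of u]) (use uH cau in blast)+
  have "ip f (v m) = x m" for m
  proof -
    have "ip (u n) (v m) = x m" if "n > m" for n
    proof -
      have "ip (u n) (v m) = (\<Sum>i<n. x i * ip (w i) (v m))"
        unfolding u_def using v_mem w_mem by (intro ip_lincomb) auto
      also have "\<dots> = (\<Sum>i<n. if i = m then x i else 0)"
        by (intro sum.cong) (auto simp: ip_w_v)
      finally show ?thesis using that by simp
    qed
    then have "(\<lambda>n. ip (u n) (v m)) \<longlonglongrightarrow> x m"
      by (intro tendsto_eventually eventually_at_top_dense[THEN iffD2]) auto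
    moreover have "(\<lambda>n. ip (u n) (v m)) \<longlonglongrightarrow> ip f (v m)"
      using uH f v_mem lim by (intro ip_tendsto)
    ultimately show ?thesis by (metis LIMSEQ_unique)
  qed
  with f that show thesis by blast
qed

end

subsection \<open>Projection onto closed spans and finite dimension\<close>

context pre_hilbert
begin

text \<open>Subtracting the optimal multiple of \<open>s\<close> lowers
  \<open>(hnorm g)\<^sup>2\<close> by \<open>(cmod (ip g s))\<^sup>2 / (hnorm s)\<^sup>2\<close>.
  Since \<open>D\<close> is a lower bound, this decrease is at most
  \<open>\<delta>\<^sup>2\<close>.\<close>

lemma near_minimal_almost_orthogonal:
  assumes g: "g \<in> H" and s: "s \<in> H" and \<delta>: "\<delta> \<ge> 0"
    and D: "\<And>c. D \<le> (hnorm (g - cscale c s))\<^sup>2" and g_le: "(hnorm g)\<^sup>2 \<le> D + \<delta>\<^sup>2"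
  shows "cmod (ip g s) \<le> \<delta> * hnorm s"
proof (cases "s = 0")
  case True
  then show ?thesis using g by (simp add: ip_zero_right hnorm_zero)
next
  case False
  define G where "G = (hnorm s)\<^sup>2"
  have G: "G > 0" using False s hnorm_eq_0 by (simp add: G_def)
  define a where "a = ip g s"
  define c where "c = a / of_real G"
  have m: "cscale c s \<in> H" using s by (rule scale_mem)
  have "ip (g - cscale c s) (g - cscale c s)
      = ip g g - cnj c * a - c * cnj a + c * cnj c * of_real G"
    using g s m ip_cnj[of g s]
    by (simp add: ip_diff ip_diff_right diff_mem ip_scale ip_scale_right ip_self[of s]
        a_def G_def algebra_simps)
  also have "\<dots> = of_real ((hnorm g)\<^sup>2) - a * cnj a / of_real G"
    using G g by (simp add: c_def ip_self field_simps)
  also have "\<dots> = of_real ((hnorm g)\<^sup>2 - (cmod a)\<^sup>2 / G)"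
    by (simp only: complex_norm_square[symmetric] of_real_diff of_real_divide)
  finally have "(hnorm (g - cscale c s))\<^sup>2 = (hnorm g)\<^sup>2 - (cmod a)\<^sup>2 / G"
    using hnorm_square[OF diff_mem[OF g m]] by simp
  then have "(cmod a)\<^sup>2 / G \<le> \<delta>\<^sup>2" using D[of c] g_le by simp
  then have "(cmod a)\<^sup>2 \<le> (\<delta> * hnorm s)\<^sup>2"
    using G by (simp add: field_simps G_def power_mult_distrib)
  then show ?thesis
    unfolding a_def by (rule power2_le_imp_le) (simp add: \<delta> s hnorm_nonneg)
qed

text \<open>Projection theorem: near-minimizers of the distance from \<open>f\<close> to the span
  converge to some \<open>g\<close>, and \<open>f - g\<close> is orthogonal to the system, so
  \<open>f = g\<close> lies in the closure.\<close>

lemma complete_system_if_orth_complement_trivial: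
  assumes mc: mcomplete and wH: "w ` I \<subseteq> H" and triv: "orth_complement (w ` I) \<subseteq> {0}"
  shows "complete_system w I"
proof -
  let ?V = "cfun.span (w ` I)"
  have VH: "?V \<subseteq> H" using wH by (rule span_subset_H)
  have "f \<in> mtopology closure_of ?V" if f: "f \<in> H" for f
  proof -
    define D where "D = (INF s\<in>?V. (hnorm (f - s))\<^sup>2)"
    have bdd: "bdd_below ((\<lambda>s. (hnorm (f - s))\<^sup>2) ` ?V)" by (rule bdd_belowI[of _ 0]) auto
    have D_le: "D \<le> (hnorm (f - s))\<^sup>2" if "s \<in> ?V" for s
      unfolding D_def using bdd that by (rule cINF_lower)
    have "\<exists>s\<in>?V. (hnorm (f - s))\<^sup>2 \<le> D + (1 / real (Suc n))\<^sup>2" for n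
    proof -
      have "(INF s\<in>?V. (hnorm (f - s))\<^sup>2) < D + (1 / real (Suc n))\<^sup>2"
        by (simp add: D_def)
      then show ?thesis
        using cINF_less_iff[OF _ bdd] cfun.span_zero by (metis empty_iff less_imp_le)
    qed
    then obtain s where sV: "\<And>n. s n \<in> ?V"
      and s: "\<And>n. (hnorm (f - s n))\<^sup>2 \<le> D + (1 / real (Suc n))\<^sup>2" by metis
    have sH: "s n \<in> H" for n using sV VH by blast
    have almost: "cmod (ip (f - s n) r) \<le> 1 / real (Suc n) * hnorm r" if r: "r \<in> ?V" for r n
    proof (rule near_minimal_almost_orthogonal[OF diff_mem[OF f sH] _ _ _ s])
      show "r \<in> H" using r VH by blast
      show "D \<le> (hnorm (f - s n - cscale c r))\<^sup>2" for c
        using D_le[OF cfun.span_add[OF sV cfun.span_scale[OF r]], of n c]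
        by (simp only: diff_diff_add)
    qed simp
    \<comment> \<open>The difference \<open>?r\<close> lies in the span, so both residuals are
      almost orthogonal to it; \<open>ip ?r ?r\<close> is the difference of these two small inner
      products.\<close>
    have dist: "hnorm (s m - s n) \<le> 1 / real (Suc m) + 1 / real (Suc n)" for m n
    proof -
      let ?r = "s m - s n"
      have rV: "?r \<in> ?V" using sV by (intro cfun.span_diff)
      then have rH: "?r \<in> H" using VH by blast
      have "?r = (f - s n) - (f - s m)" by simp
      then have "ip ?r ?r = ip (f - s n) ?r - ip (f - s m) ?r"
        using ip_diff[OF diff_mem[OF f sH[of n]] diff_mem[OF f sH[of m]] rH] by simp
      then have "(hnorm ?r)\<^sup>2 \<le> cmod (ip (f - s n) ?r) + cmod (ip (f - s m) ?r)"
        using ip_self[OF rH] norm_triangle_ineq4[of "ip (f - s n) ?r" "ip (f - s m) ?r"]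
        by (metis norm_of_real abs_of_nonneg zero_le_power2)
      also have "\<dots> \<le> (1 / real (Suc m) + 1 / real (Suc n)) * hnorm ?r"
        using almost[OF rV, of n] almost[OF rV, of m] by (simp add: algebra_simps)
      finally show ?thesis
        using hnorm_nonneg[OF rH]
        by (cases "hnorm ?r = 0") (auto simp: power2_eq_square)
    qed
    have cau: "\<exists>N. \<forall>m\<ge>N. \<forall>n\<ge>N. hnorm (s m - s n) < \<epsilon>" if "\<epsilon> > 0" for \<epsilon>
    proof -
      obtain N where N: "1 / real (Suc N) < \<epsilon> / 2"
        using nat_approx_posE[of "\<epsilon> / 2"] \<open>\<epsilon> > 0\<close> by auto
      have "1 / real (Suc n) < \<epsilon> / 2" if "n \<ge> N" for n
        using N that by (meson inverse_of_nat_le le_less_trans of_nat_0_less_iff Suc_le_mono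
            frac_le le_numeral_extra(4) of_nat_le_iff zero_less_Suc zero_le_one)
      then have "hnorm (s m - s n) < \<epsilon>" if "m \<ge> N" "n \<ge> N" for m n
        using dist[of m n] that by (smt (verit) field_sum_of_halves)
      then show ?thesis by blast
    qed
    obtain g where g: "g \<in> H" and lim: "(\<lambda>n. hnorm (s n - g)) \<longlonglongrightarrow> 0"
      by (rule hnorm_Cauchy_convergent[OF mc, of s]) (use sH cau in blast)+
    have "ip (f - g) (w i) = 0" if i: "i \<in> I" for i
    proof -
      have wV: "w i \<in> ?V" using i by (intro cfun.span_base) simp
      then have wiH: "w i \<in> H" using VH by blast
      have "(\<lambda>n. ip f (w i) - ip (s n) (w i)) \<longlonglongrightarrow> ip f (w i) - ip g (w i)"
        using ip_tendsto[OF sH g wiH lim] by (intro tendsto_intros)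
      moreover have "(\<lambda>n. ip f (w i) - ip (s n) (w i)) \<longlonglongrightarrow> 0"
      proof (rule Lim_null_comparison)
        show "\<forall>\<^sub>F n in sequentially. cmod (ip f (w i) - ip (s n) (w i)) \<le> 1 / real (Suc n) * hnorm (w i)"
          using almost[OF wV] by (simp add: ip_diff[OF f sH wiH])
        show "(\<lambda>n. 1 / real (Suc n) * hnorm (w i)) \<longlonglongrightarrow> 0"
          by (intro tendsto_mult_left_zero) (use lim_1_over_n LIMSEQ_Suc in blast)
      qed
      ultimately have "ip f (w i) - ip g (w i) = 0" by (rule LIMSEQ_unique)
      then show ?thesis using f g wiH by (simp add: ip_diff)
    qed
    then have "f - g \<in> orth_complement (w ` I)"
      using diff_mem[OF f g] by (auto simp: orth_complement_def)
    then have "f = g" using triv by auto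
    with lim have lim: "(\<lambda>n. hnorm (s n - f)) \<longlonglongrightarrow> 0" by simp
    show ?thesis
      unfolding metric_closure_of
    proof (intro CollectI conjI f allI impI)
      fix r :: real assume "r > 0"
      then obtain n where "hnorm (s n - f) < r"
        using lim hnorm_nonneg[OF diff_mem[OF sH f]] unfolding LIMSEQ_iff by force
      then have "s n \<in> mball f r"
        using f sH hnorm_diff_commute[OF f sH] by (simp add: hdist_def)
      then show "\<exists>y\<in>?V. y \<in> mball f r" using sV by blast
    qed
  qed
  then show ?thesis
    unfolding complete_system_def using wH closure_of_subset_topspace[of mtopology ?V] by auto
qed

end

text \<open>A vector \<open>u\<close> with \<open>\<phi> u \<noteq> 0\<close> spans a complement of
  the kernel: subtracting \<open>\<phi> h / \<phi> u\<close> times \<open>u\<close> from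
  \<open>h\<close> lands in the kernel.\<close>

lemma finite_dim_kernel:
  assumes V: "cfun.subspace V"
    and add: "\<And>f g. f \<in> V \<Longrightarrow> g \<in> V \<Longrightarrow> \<phi> (f + g) = \<phi> f + \<phi> g"
    and scale: "\<And>c f. f \<in> V \<Longrightarrow> \<phi> (cscale c f) = c * \<phi> f"
    and ker: "finite_dim {h \<in> V. \<phi> h = (0 :: complex)}"
  shows "finite_dim V"
proof (cases "\<exists>u\<in>V. \<phi> u \<noteq> 0")
  case False
  then have "{h \<in> V. \<phi> h = 0} = V" by auto
  with ker show ?thesis by simp
next
  case True
  then obtain u where u: "u \<in> V" "\<phi> u \<noteq> 0" by blast
  obtain B where B: "finite B" "{h \<in> V. \<phi> h = 0} = cfun.span B"
    using ker by (auto simp: finite_dim_def)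
  have "V = cfun.span (insert u B)"
  proof
    show "cfun.span (insert u B) \<subseteq> V"
      using V u B(2) by (intro cfun.span_minimal) (auto intro: cfun.span_base)
    show "V \<subseteq> cfun.span (insert u B)"
    proof
      fix h assume h: "h \<in> V"
      define c where "c = \<phi> h / \<phi> u"
      have hV: "h + cscale (- c) u \<in> V"
        using V h u(1) by (intro cfun.subspace_add cfun.subspace_scale)
      have "\<phi> (h + cscale (- c) u) = 0"
        unfolding add[OF h cfun.subspace_scale[OF V u(1)]] scale[OF u(1)] c_def using u(2) by simp
      with hV have "h + cscale (- c) u \<in> cfun.span B" using B(2) by blast
      then have "h - cscale c u \<in> cfun.span B"
        by (simp only: cfun.scale_minus_left add_uminus_conv_diff)
      then show "h \<in> cfun.span (insert u B)"
        unfolding cfun.span_insert by blast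
    qed
  qed
  with B(1) show ?thesis unfolding finite_dim_def by blast
qed

text \<open>Induction on the number of functionals: the hypothesis is applied to the kernel of the
  last one, and \<open>finite_dim_kernel\<close> restores \<open>V\<close>. Hence \<open>V\<close>
  is kept arbitrary.\<close>

lemma finite_dim_of_functionals:
  fixes \<phi> :: "nat \<Rightarrow> (complex \<Rightarrow> complex) \<Rightarrow> complex"
  assumes "cfun.subspace V"
    and "\<And>i f g. f \<in> V \<Longrightarrow> g \<in> V \<Longrightarrow> \<phi> i (f + g) = \<phi> i f + \<phi> i g"
    and "\<And>i c f. f \<in> V \<Longrightarrow> \<phi> i (cscale c f) = c * \<phi> i f"
    and "{h \<in> V. \<forall>i<m. \<phi> i h = 0} \<subseteq> {0}"
  shows "finite_dim V"
  using assms
proof (induction m arbitrary: V)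
  case 0
  have "V \<subseteq> {0}" using 0(4) by blast
  then have "V = cfun.span {}" using cfun.subspace_0[OF 0(1)] unfolding cfun.span_empty by blast
  then show ?case unfolding finite_dim_def by blast
next
  case (Suc m)
  let ?V = "{h \<in> V. \<phi> m h = 0}"
  have "\<phi> m 0 = 0"
    using Suc.prems(3)[OF cfun.subspace_0[OF Suc.prems(1)], of m 0]
    by (simp only: cfun.scale_zero_left mult_zero_left)
  then have sub: "cfun.subspace ?V"
    using Suc.prems(2)[of _ _ m] Suc.prems(3)[of _ m] cfun.subspace_0[OF Suc.prems(1)]
      cfun.subspace_add[OF Suc.prems(1)] cfun.subspace_scale[OF Suc.prems(1)]
    by (intro cfun.subspaceI) (simp_all del: plus_fun_apply)
  have "finite_dim ?V"
    using sub Suc.prems(2-4) by (intro Suc.IH) (auto simp: less_Suc_eq)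
  then show ?case
    by (intro finite_dim_kernel[OF Suc.prems(1), of "\<phi> m"] Suc.prems(2,3))
qed

subsection \<open>Partial fraction expansions in spaces with a generating function\<close>

lemma entire_zero_if_eventually_zero:
  fixes f :: "complex \<Rightarrow> complex"
  assumes "f holomorphic_on UNIV" and ev: "eventually (\<lambda>z. f z = 0) (at l)"
  shows "f l = 0"
proof -
  have "isCont f l"
    using holomorphic_on_imp_continuous_on[OF assms(1)] by (simp add: continuous_on_eq_continuous_at)
  then have "(f \<longlongrightarrow> f l) (at l)" by (simp add: isCont_def)
  moreover have "(f \<longlongrightarrow> 0) (at l)" using ev by (rule tendsto_eventually)
  ultimately show ?thesis by (metis LIM_unique)
qed

lemma entire_zeros_finite_in_cball:
  fixes f :: "complex \<Rightarrow> complex"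
  assumes "f holomorphic_on UNIV" "f a \<noteq> 0"
  shows "finite {z \<in> cball 0 r. f z = 0}"
proof (cases "f constant_on UNIV")
  case True
  then have "{z \<in> cball 0 r. f z = 0} = {}" using assms(2) by (auto simp: constant_on_def)
  then show ?thesis by (simp only: finite.emptyI)
next
  case False
  then show ?thesis using assms(1) by (intro holomorphic_compact_finite_zeros[of f UNIV]) auto
qed

lemma entire_zeros_countable:
  fixes f :: "complex \<Rightarrow> complex"
  assumes "f holomorphic_on UNIV" "f a \<noteq> 0"
  shows "countable {z. f z = 0}"
proof -
  have "{z. f z = 0} = (\<Union>n. {z \<in> cball 0 (real n). f z = 0})"
    by (auto intro: real_arch_simple)
  then show ?thesis
    using entire_zeros_finite_in_cball[OF assms] by (simp add: countable_finite)
qed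

section \<open>Values at the points \<open>t n\<close> as coordinates\<close>

locale generated_class_R = class_R H ip k t
  for H :: "(complex \<Rightarrow> complex) set"
    and ip :: "(complex \<Rightarrow> complex) \<Rightarrow> (complex \<Rightarrow> complex) \<Rightarrow> complex"
    and k :: "complex \<Rightarrow> (complex \<Rightarrow> complex)" and t :: "nat \<Rightarrow> complex" +
  fixes F :: "complex \<Rightarrow> complex"
  assumes generating: "generating_function F"
begin

abbreviation \<nu> :: "nat \<Rightarrow> real" where
  "\<nu> n \<equiv> hnorm (k (t n))"

abbreviation W :: "nat \<Rightarrow> complex \<Rightarrow> complex" where
  "W n \<equiv> cscale (of_real (\<nu> n) / deriv F (t n)) (divide_zero F (t n))"

sublocale R: riesz_pair H ip "\<lambda>n. normalize_vec (k (t n))" W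
  using generating
  by unfold_locales (auto simp: generating_function_def hilbert A3_riesz)

lemma F_entire: "F holomorphic_on UNIV"
  using generating by (simp add: generating_function_def)

lemma \<nu>_pos: "\<nu> n > 0" and deriv_F_nonzero: "deriv F (t n) \<noteq> 0"
proof -
  have "\<nu> n \<noteq> 0"
  proof
    assume "\<nu> n = 0"
    then have "normalize_vec (k (t n)) = 0" by (simp add: normalize_vec_def)
    then show False using R.ip_v_w[of n n] ip_zero[OF R.w_mem[of n]] by simp
  qed
  then show "\<nu> n > 0" using hnorm_nonneg[OF A1_mem, of "t n"] by linarith
  show "deriv F (t n) \<noteq> 0"
  proof
    assume "deriv F (t n) = 0"
    \<comment> \<open>Division by zero yields zero, so the coefficient in \<open>W n\<close> would
      vanish, against biorthogonality.\<close>
    then have "W n = 0" by (simp only: division_ring_divide_zero cfun.scale_zero_left)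
    then have "ip (normalize_vec (k (t n))) (W n) = 0"
      by (simp only: ip_zero_right[OF R.v_mem])
    then show False using R.ip_v_w[of n n] by (metis zero_neq_one)
  qed
qed

lemma ip_normalize: "f \<in> H \<Longrightarrow> ip f (normalize_vec (k (t n))) = f (t n) / of_real (\<nu> n)"
  by (simp add: normalize_vec_def ip_scale_right A1_mem A1_reproducing)

text \<open>Biorthogonality makes \<open>W (Suc n)\<close> vanish at \<open>t n\<close>, where it is
  a nonzero multiple of \<open>F (t n)\<close>. Any index other than \<open>n\<close> would
  serve.\<close>

lemma F_t: "F (t n) = 0"
proof -
  have "W (Suc n) (t n) / of_real (\<nu> n) = 0"
    using R.ip_w_v[of "Suc n" n] ip_normalize[OF R.w_mem, of "Suc n" n] by simp
  moreover have "t n \<noteq> t (Suc n)" using A3_distinct by (auto dest: injD)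
  ultimately show ?thesis
    using \<nu>_pos[of n] \<nu>_pos[of "Suc n"] deriv_F_nonzero[of "Suc n"]
    by (simp add: cscale_def divide_zero_def)
qed

lemma F_nonzero_somewhere: "\<exists>a. F a \<noteq> 0"
proof (rule ccontr)
  assume "\<not> ?thesis"
  then have "F = (\<lambda>_. 0)" by auto
  then show False using deriv_F_nonzero[of 0] by simp
qed

text \<open>The \<open>t n\<close> are distinct zeros of an entire function that is not identically
  zero.\<close>

lemma finite_t_bounded: "finite {n. cmod (t n) \<le> r}"
proof -
  obtain a where "F a \<noteq> 0" using F_nonzero_somewhere by blast
  then have "finite {z \<in> cball 0 r. F z = 0}"
    using F_entire by (intro entire_zeros_finite_in_cball)
  then have "finite (t ` {n. cmod (t n) \<le> r})"
    by (rule finite_subset[rotated]) (auto simp: F_t)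
  then show ?thesis
    by (rule finite_imageD) (use A3_distinct in \<open>auto intro: inj_on_subset\<close>)
qed

lemma W_eval: "z \<notin> range t \<Longrightarrow> W n z = of_real (\<nu> n) / deriv F (t n) * (F z / (z - t n))"
  by (auto simp: cscale_def divide_zero_def)

lemma summable_square_values: "f \<in> H \<Longrightarrow> summable (\<lambda>n. (cmod (f (t n) / of_real (\<nu> n)))\<^sup>2)"
  using R.summable_square_ip_v[of f] by (simp add: ip_normalize)

lemma parseval_values:
  "f \<in> H \<Longrightarrow> h \<in> H \<Longrightarrow> (\<lambda>n. f (t n) / of_real (\<nu> n) * ip (W n) h) sums ip f h"
  using R.parseval[of f h] by (simp add: ip_normalize)

text \<open>The converse of \<open>summable_square_values\<close>, by Riesz-Fischer.\<close>

lemma interpolation: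
  assumes "summable (\<lambda>n. (cmod (x n / of_real (\<nu> n)))\<^sup>2)"
  obtains f where "f \<in> H" "\<And>n. f (t n) = x n"
proof -
  obtain f where f: "f \<in> H"
    and fx: "\<And>n. ip f (normalize_vec (k (t n))) = x n / of_real (\<nu> n)"
    using R.riesz_fischer[OF assms] by metis
  have "f (t n) = x n" for n
    using fx[of n] \<nu>_pos[of n] by (simp add: ip_normalize[OF f])
  with f that show thesis by blast
qed

text \<open>Parseval with \<open>h = k z\<close>: the reproducing property turns
  \<open>ip (W n) (k z)\<close> into \<open>W n z\<close>, and \<open>\<nu> n\<close> cancels. This
  is the partial fraction expansion of \<open>f / F\<close>, multiplied by \<open>F\<close>.\<close>

lemma cauchy_expansion:
  assumes f: "f \<in> H" and z: "z \<notin> range t"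
  shows "(\<lambda>n. f (t n) / deriv F (t n) * (F z / (z - t n))) sums f z"
proof -
  have "(\<lambda>n. f (t n) / of_real (\<nu> n) * ip (W n) (k z)) sums ip f (k z)"
    using f A1_mem by (rule parseval_values)
  moreover have "f (t n) / of_real (\<nu> n) * ip (W n) (k z) =
      f (t n) / deriv F (t n) * (F z / (z - t n))" for n
    using A1_reproducing[OF R.w_mem, of n z] \<nu>_pos[of n] by (simp add: W_eval[OF z])
  ultimately show ?thesis using A1_reproducing[OF f] by simp
qed

lemma range_t_separated:
  assumes "p \<notin> range t"
  obtains D where "D > 0" "\<And>n. 1 + cmod (t n) \<le> D * cmod (t n - p)"
proof -
  \<comment> \<open>Outside the disc of radius \<open>r\<close> the triangle inequality gives the
    constant 3. The finitely many remaining points enter through a maximum, and the inserted 2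
    ensures \<open>D \<ge> 3\<close>.\<close>
  define r where "r = 1 + 2 * cmod p"
  define A where "A = insert 2 ((\<lambda>n. (1 + cmod (t n)) / cmod (t n - p)) ` {n. cmod (t n) \<le> r})"
  define D where "D = 1 + Max A"
  have fin: "finite A" unfolding A_def using finite_t_bounded by simp
  then have "2 \<le> Max A" by (rule Max_ge) (simp add: A_def)
  then have D: "D \<ge> 3" by (simp add: D_def)
  have pos: "cmod (t n - p) > 0" for n using assms by auto
  have "1 + cmod (t n) \<le> D * cmod (t n - p)" for n
  proof (cases "cmod (t n) \<le> r")
    case True
    then have "(1 + cmod (t n)) / cmod (t n - p) \<le> Max A"
      using fin by (intro Max_ge) (auto simp: A_def)
    then have "(1 + cmod (t n)) / cmod (t n - p) \<le> D" by (simp add: D_def)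
    then show ?thesis using pos[of n] by (simp add: divide_le_eq)
  next
    case False
    have "cmod (t n) - cmod p \<le> cmod (t n - p)" by (rule norm_triangle_ineq2)
    then have "1 + cmod (t n) \<le> 3 * cmod (t n - p)"
      using False norm_ge_zero[of p] unfolding r_def by linarith
    also have "\<dots> \<le> D * cmod (t n - p)" using D by (intro mult_right_mono) auto
    finally show ?thesis .
  qed
  with D show thesis by (intro that[of D]) auto
qed

end

subsection \<open>Exact systems of reproducing kernels\<close>

locale exact_kernel_system = generated_class_R H ip k t F
  for H :: "(complex \<Rightarrow> complex) set"
    and ip :: "(complex \<Rightarrow> complex) \<Rightarrow> (complex \<Rightarrow> complex) \<Rightarrow> complex"
    and k :: "complex \<Rightarrow> (complex \<Rightarrow> complex)" and t :: "nat \<Rightarrow> complex"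
    and F :: "complex \<Rightarrow> complex" +
  fixes \<Lambda> :: "complex set" and v :: "complex \<Rightarrow> complex \<Rightarrow> complex"
  assumes exact: "exact_system k \<Lambda>" and kernel_biorth: "biorthogonal k v \<Lambda>"
begin

section \<open>Zeros of the biorthogonal functions \<open>v l\<close>\<close>

lemma v_mem: "l \<in> \<Lambda> \<Longrightarrow> v l \<in> H"
  using kernel_biorth by (auto simp: biorthogonal_def)

lemma v_at: "l \<in> \<Lambda> \<Longrightarrow> m \<in> \<Lambda> \<Longrightarrow> v l m = (if m = l then 1 else 0)"
  using kernel_biorth A1_reproducing[OF v_mem, of l m] ip_cnj[OF A1_mem v_mem, of l m]
  by (auto simp: biorthogonal_def)

lemma uniqueness_set:
  assumes f: "f \<in> H" and zero: "\<And>l. l \<in> \<Lambda> \<Longrightarrow> f l = 0"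
  shows "f = 0"
proof (rule complete_system_orthogonal[OF _ f])
  show "complete_system k \<Lambda>" using exact by (simp add: exact_system_def)
  show "ip f (k l) = 0" if "l \<in> \<Lambda>" for l using A1_reproducing[OF f] zero[OF that] by simp
qed

lemma \<Lambda>_nonempty: "\<Lambda> \<noteq> {}"
proof
  assume "\<Lambda> = {}"
  then have "k (t 0) = 0" using uniqueness_set[OF A1_mem] by blast
  then show False using \<nu>_pos[of 0] hnorm_zero by simp
qed

text \<open>The identities obtained by moving zeros say nothing at \<open>l\<close> and
  \<open>p\<close>; continuity at \<open>l\<close> still forces \<open>v l l = 0\<close>, whereas
  biorthogonality gives 1.\<close>

lemma v_not_eventually_zero:
  assumes "l \<in> \<Lambda>" and zero: "\<And>z. z \<noteq> l \<Longrightarrow> z \<noteq> p \<Longrightarrow> v l z = 0"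
  shows False
proof -
  have "eventually (\<lambda>z. v l z = 0) (at l)"
  proof (cases "p = l")
    case True
    then show ?thesis using zero by (auto simp: eventually_at_filter)
  next
    case False
    then have "eventually (\<lambda>z. z \<noteq> p) (nhds l)" by (intro t1_space_nhds) auto
    then show ?thesis
      unfolding eventually_at_filter by (rule eventually_mono) (use zero in auto)
  qed
  then have "v l l = 0"
    using entire[OF v_mem[OF assms(1)]] by (intro entire_zero_if_eventually_zero)
  then show False using v_at assms(1) by simp
qed

text \<open>Trades the zero at \<open>m\<close> for one at \<open>l\<close>: since
  \<open>(z - l) / (z - m) = 1 + (m - l) / (z - m)\<close>, axiom \<open>A2\<close> keeps the result
  in \<open>H\<close>.\<close>

lemma move_zero:
  assumes l: "l \<in> \<Lambda>" and zero: "v l m = 0"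
  obtains u where "u \<in> H" "\<And>z. z \<noteq> m \<Longrightarrow> u z = v l z * (z - l) / (z - m)"
proof
  let ?u = "v l + cscale (m - l) (divide_zero (v l) m)"
  show "?u \<in> H" using A2[OF v_mem[OF l] zero] v_mem[OF l] by (intro add_mem scale_mem)
  show "?u z = v l z * (z - l) / (z - m)" if "z \<noteq> m" for z
  proof -
    have "z - m \<noteq> 0" using that by simp
    then have "v l z + (m - l) * (v l z / (z - m)) = v l z * (z - l) / (z - m)"
      by (simp add: divide_simps) (simp add: algebra_simps)
    then show ?thesis using that by (simp add: cscale_def divide_zero_def)
  qed
qed

text \<open>A zero at \<open>p\<close> outside \<open>\<Lambda>\<close> could be traded for one at
  \<open>l\<close>, leaving an element of \<open>H\<close> that vanishes on all of
  \<open>\<Lambda>\<close>.\<close>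

lemma v_nonzero:
  assumes l: "l \<in> \<Lambda>" and p: "p \<notin> \<Lambda>"
  shows "v l p \<noteq> 0"
proof
  assume "v l p = 0"
  then obtain u where u: "u \<in> H" and uz: "\<And>z. z \<noteq> p \<Longrightarrow> u z = v l z * (z - l) / (z - p)"
    using move_zero[OF l] by metis
  have "u = 0"
  proof (rule uniqueness_set[OF u])
    fix m assume m: "m \<in> \<Lambda>"
    then have "m \<noteq> p" using p by blast
    then show "u m = 0" using v_at[OF l m] uz[of m] by auto
  qed
  then have "v l z = 0" if "z \<noteq> l" "z \<noteq> p" for z
    using uz[of z] that by simp
  then show False by (rule v_not_eventually_zero[OF l])
qed

text \<open>Up to a constant, \<open>(z - l) * v l z\<close> is one function attached to
  \<open>\<Lambda>\<close>. Trading the zero of \<open>v l\<close> at \<open>m\<close> for one at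
  \<open>l\<close> leaves a function vanishing on \<open>\<Lambda>\<close> except perhaps at
  \<open>m\<close>, hence a multiple of \<open>v m\<close>.\<close>

lemma v_ratio:
  assumes l: "l \<in> \<Lambda>" and m: "m \<in> \<Lambda>"
  obtains c where "c \<noteq> 0" "\<And>z. (z - l) * v l z = c * ((z - m) * v m z)"
proof (cases "l = m")
  case True
  then show thesis using that[of 1] by simp
next
  case False
  have ml: "v l m = 0" using v_at[OF l m] False by simp
  obtain u where u: "u \<in> H" and uz: "\<And>z. z \<noteq> m \<Longrightarrow> u z = v l z * (z - l) / (z - m)"
    using move_zero[OF l ml] by metis
  define c where "c = u m"
  have "u - cscale c (v m) = 0"
  proof (rule uniqueness_set)
    show "u - cscale c (v m) \<in> H" using u v_mem[OF m] by (intro diff_mem scale_mem)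
    fix x assume x: "x \<in> \<Lambda>"
    show "(u - cscale c (v m)) x = 0"
      using v_at[OF l x] v_at[OF m x] uz[of x]
      by (cases "x = m") (auto simp: c_def cscale_def)
  qed
  then have "u = cscale c (v m)" by simp
  then have eq: "(z - l) * v l z = c * ((z - m) * v m z)" for z
    using uz[of z] ml by (cases "z = m") (auto simp: cscale_def field_simps)
  moreover have "c \<noteq> 0"
  proof
    assume "c = 0"
    then have "v l z = 0" if "z \<noteq> l" for z using eq[of z] that by simp
    then show False using v_not_eventually_zero[OF l, of l] by blast
  qed
  ultimately show thesis using that by blast
qed

text \<open>Apart from \<open>l\<close>, all of \<open>\<Lambda>\<close> consists of zeros of
  \<open>v l\<close>, so avoiding two countable zero sets and \<open>l\<close> is enough.\<close>

lemma regular_point: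
  obtains p where "F p \<noteq> 0" "p \<notin> \<Lambda>"
proof -
  obtain l where l: "l \<in> \<Lambda>" using \<Lambda>_nonempty by blast
  obtain a where "F a \<noteq> 0" using F_nonzero_somewhere by blast
  then have "countable {z. F z = 0}" using F_entire by (intro entire_zeros_countable)
  moreover have "countable {z. v l z = 0}"
    using entire[OF v_mem[OF l]] v_at[OF l l] by (intro entire_zeros_countable[of _ l]) auto
  ultimately have "countable (insert l ({z. F z = 0} \<union> {z. v l z = 0}))" by simp
  then have "insert l ({z. F z = 0} \<union> {z. v l z = 0}) \<noteq> UNIV"
    using uncountable_UNIV_complex by metis
  then obtain p where p: "p \<noteq> l" "F p \<noteq> 0" "v l p \<noteq> 0" by blast
  have "p \<notin> \<Lambda>" using v_at[OF l, of p] p by auto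
  with p that show thesis by blast
qed

text \<open>An \<open>h\<close> orthogonal to the system \<open>v\<close> is encoded by the values at the points \<open>t n\<close> of the
  entire function \<open>S\<close> for which \<open>v l * S / F\<close> has the partial fraction expansion with
  residues \<open>\<sigma> n * v l (t n) / F' (t n)\<close>, for every \<open>l\<close> in \<open>\<Lambda>\<close>.\<close>

definition defect :: "(nat \<Rightarrow> complex) \<Rightarrow> bool" where
  "defect \<sigma> \<longleftrightarrow> summable (\<lambda>n. (cmod (\<sigma> n * of_real (\<nu> n) / deriv F (t n)))\<^sup>2) \<and>
     (\<forall>l\<in>\<Lambda>. (\<lambda>n. \<sigma> n * v l (t n) / deriv F (t n)) sums 0)"

text \<open>The factor is chosen so that the weighted sequence is again \<open>ip (W n) h\<close>,
  and the annihilation condition is Parseval for \<open>ip (v l) h = 0\<close>.\<close>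

lemma defect_of_orthogonal:
  assumes h: "h \<in> orth_complement (v ` \<Lambda>)"
  shows "defect (\<lambda>n. ip (W n) h * deriv F (t n) / of_real (\<nu> n))"
proof -
  have hH: "h \<in> H" and orth: "\<And>l. l \<in> \<Lambda> \<Longrightarrow> ip h (v l) = 0"
    using h by (auto simp: orth_complement_def)
  have \<nu>: "complex_of_real (\<nu> n) \<noteq> 0" for n using \<nu>_pos[of n] by simp
  have "(\<lambda>n. v l (t n) / of_real (\<nu> n) * ip (W n) h) sums 0" if l: "l \<in> \<Lambda>" for l
    using parseval_values[OF v_mem[OF l] hH] ip_cnj[OF hH v_mem[OF l]] orth[OF l] by simp
  then show ?thesis
    unfolding defect_def using R.summable_square_ip_w[OF hH] \<nu> deriv_F_nonzero
    by (simp add: field_simps)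
qed

text \<open>This is the step from \<open>S\<close> to \<open>(S - S(p)) / (z - p)\<close>. One
  constant \<open>s\<close> must work for all \<open>l\<close>; it does because
  \<open>X l / v l p\<close> is independent of \<open>l\<close>.\<close>

lemma defect_shift:
  assumes \<sigma>: "defect \<sigma>" and Fp: "F p \<noteq> 0" and p: "p \<notin> \<Lambda>"
  obtains s where "defect (\<lambda>n. (\<sigma> n - s) / (t n - p))"
proof -
  have pt: "p \<notin> range t" using Fp F_t by auto
  then have tp: "t n \<noteq> p" "p \<noteq> t n" for n by auto
  obtain D where D: "D > 0" "\<And>n. 1 + cmod (t n) \<le> D * cmod (t n - p)"
    by (rule range_t_separated[OF pt]) blast
  have inv_le: "1 / cmod (t n - p) \<le> D" for n
  proof -
    have "1 \<le> D * cmod (t n - p)" using D(2)[of n] norm_ge_zero[of "t n"] by linarith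
    then show ?thesis using tp(1)[of n] by (simp add: divide_le_eq)
  qed
  have \<nu>: "complex_of_real (\<nu> n) \<noteq> 0" for n using \<nu>_pos[of n] by simp
  have div_le: "cmod (a / (t n - p)) \<le> D * cmod a" for a n
    using mult_right_mono[OF inv_le[of n] norm_ge_zero[of a]] by (simp add: norm_divide)
  have sq: "summable (\<lambda>n. (cmod (\<sigma> n * of_real (\<nu> n) / deriv F (t n)))\<^sup>2)"
    and ann: "\<And>l. l \<in> \<Lambda> \<Longrightarrow> (\<lambda>n. \<sigma> n * v l (t n) / deriv F (t n)) sums 0"
    using \<sigma> by (auto simp: defect_def)
  have sq': "summable (\<lambda>n. (cmod (\<sigma> n * of_real (\<nu> n) / deriv F (t n) / (t n - p)))\<^sup>2)"
    by (rule l2_bounded_mult[OF sq]) (rule div_le)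
  define X where "X l = (\<Sum>n. \<sigma> n * v l (t n) / deriv F (t n) / (t n - p))" for l
  have X: "(\<lambda>n. \<sigma> n * v l (t n) / deriv F (t n) / (t n - p)) sums X l" if l: "l \<in> \<Lambda>" for l
  proof -
    have "summable (\<lambda>n. (\<sigma> n * of_real (\<nu> n) / deriv F (t n) / (t n - p)) * (v l (t n) / of_real (\<nu> n)))"
      by (rule l2_mult_summable[OF sq' summable_square_values[OF v_mem[OF l]]])
    then show ?thesis unfolding X_def using \<nu> by (simp add: summable_sums field_simps)
  qed
  \<comment> \<open>Writing \<open>(t n - j) / (t n - p) = 1 + (p - j) / (t n - p)\<close> and using
    annihilation gives the moment \<open>(p - j) * X j\<close>. The moments for \<open>l\<close> and
    \<open>m\<close> differ by the constant of \<open>v_ratio\<close>, as do the values at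
    \<open>p\<close>.\<close>
  have X_ratio: "X l * v m p = X m * v l p" if l: "l \<in> \<Lambda>" and m: "m \<in> \<Lambda>" for l m
  proof -
    obtain c where c: "c \<noteq> 0" "\<And>z. (z - l) * v l z = c * ((z - m) * v m z)"
      by (rule v_ratio[OF l m]) blast
    have moment: "(\<lambda>n. \<sigma> n / deriv F (t n) * ((t n - j) * v j (t n)) / (t n - p)) sums ((p - j) * X j)"
      if j: "j \<in> \<Lambda>" for j
    proof -
      have "(\<lambda>n. \<sigma> n * v j (t n) / deriv F (t n) +
          (p - j) * (\<sigma> n * v j (t n) / deriv F (t n) / (t n - p))) sums (0 + (p - j) * X j)"
        by (intro sums_add sums_mult ann X j)
      moreover have "\<sigma> n * v j (t n) / deriv F (t n) +
          (p - j) * (\<sigma> n * v j (t n) / deriv F (t n) / (t n - p)) =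
          \<sigma> n / deriv F (t n) * ((t n - j) * v j (t n)) / (t n - p)" for n
        using tp(1)[of n] deriv_F_nonzero[of n] by (simp add: divide_simps) (simp add: algebra_simps)
      ultimately show ?thesis by simp
    qed
    have "(\<lambda>n. \<sigma> n / deriv F (t n) * (c * ((t n - m) * v m (t n))) / (t n - p)) sums (c * ((p - m) * X m))"
      using sums_mult[OF moment[OF m], of c] by (simp only: mult.left_commute times_divide_eq_right)
    then have "(p - l) * X l = c * ((p - m) * X m)"
      unfolding c(2)[symmetric] by (rule sums_unique2[OF moment[OF l]])
    then have "(p - l) * X l * ((p - m) * v m p) = X m * (p - m) * (c * ((p - m) * v m p))"
      by simp
    also have "\<dots> = X m * (p - m) * ((p - l) * v l p)" by (simp only: c(2))
    finally show ?thesis using l m p by auto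
  qed
  obtain a where a: "a \<in> \<Lambda>" using \<Lambda>_nonempty by blast
  \<comment> \<open>The value \<open>S(p)\<close> predicted by the partial fraction expansion of
    \<open>v a * S / F\<close> at \<open>p\<close>.\<close>
  define s where "s = - F p * X a / v a p"
  \<comment> \<open>The part of the new sequence coming from \<open>s\<close> is a multiple of the
    coefficients of \<open>k p\<close>, because \<open>ip (W n) (k p) = W n p\<close>.\<close>
  have "summable (\<lambda>n. (cmod (\<sigma> n * of_real (\<nu> n) / deriv F (t n) / (t n - p)
      + s / F p * ip (W n) (k p)))\<^sup>2)"
  proof (rule l2_add_summable[OF sq'])
    show "summable (\<lambda>n. (cmod (s / F p * ip (W n) (k p)))\<^sup>2)"
      by (rule l2_bounded_mult[OF R.summable_square_ip_w[OF A1_mem[of p]], where C = "cmod (s / F p)"])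
        (simp add: norm_mult norm_divide)
  qed
  moreover have "\<sigma> n * of_real (\<nu> n) / deriv F (t n) / (t n - p) + s / F p * ip (W n) (k p) =
      (\<sigma> n - s) / (t n - p) * of_real (\<nu> n) / deriv F (t n)" for n
    unfolding A1_reproducing[OF R.w_mem] W_eval[OF pt]
    using tp[of n] deriv_F_nonzero[of n] Fp by (simp add: divide_simps) (simp add: algebra_simps)
  ultimately have 1: "summable (\<lambda>n. (cmod ((\<sigma> n - s) / (t n - p) * of_real (\<nu> n) / deriv F (t n)))\<^sup>2)"
    by simp
  have 2: "(\<lambda>n. (\<sigma> n - s) / (t n - p) * v l (t n) / deriv F (t n)) sums 0" if l: "l \<in> \<Lambda>" for l
  proof -
    \<comment> \<open>The expansion of \<open>v l\<close> at \<open>p\<close> sums the contribution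
      of \<open>s\<close> to \<open>s / F p * v l p\<close>, which cancels
      \<open>X l\<close>.\<close>
    have "(\<lambda>n. \<sigma> n * v l (t n) / deriv F (t n) / (t n - p) +
        s / F p * (v l (t n) / deriv F (t n) * (F p / (p - t n)))) sums (X l + s / F p * v l p)"
      by (intro sums_add sums_mult X l cauchy_expansion v_mem pt)
    moreover have "X l + s / F p * v l p = 0"
      using X_ratio[OF l a] v_nonzero[OF a p] Fp by (simp add: s_def field_simps)
    moreover have "\<sigma> n * v l (t n) / deriv F (t n) / (t n - p) +
        s / F p * (v l (t n) / deriv F (t n) * (F p / (p - t n))) =
        (\<sigma> n - s) / (t n - p) * v l (t n) / deriv F (t n)" for n
      using tp[of n] deriv_F_nonzero[of n] Fp by (simp add: divide_simps) (simp add: algebra_simps)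
    ultimately show ?thesis by simp
  qed
  from 1 2 have "defect (\<lambda>n. (\<sigma> n - s) / (t n - p))" by (simp add: defect_def)
  with that show thesis by blast
qed

text \<open>Decay makes \<open>(t n - l) * \<sigma> n\<close> bounded, so the values of
  \<open>(z - l) * v l * S\<close> are interpolated by some \<open>B\<close> in \<open>H\<close>. It
  vanishes on \<open>\<Lambda>\<close>, so \<open>B = 0\<close>; this settles \<open>t n\<close>
  outside \<open>\<Lambda>\<close>, and annihilation settles the rest.\<close>

lemma defect_decaying_zero:
  assumes \<sigma>: "defect \<sigma>" and decay: "\<And>n. cmod (\<sigma> n) * (1 + cmod (t n)) \<le> C"
  shows "\<sigma> n = 0"
proof -
  have ann: "\<And>l. l \<in> \<Lambda> \<Longrightarrow> (\<lambda>n. \<sigma> n * v l (t n) / deriv F (t n)) sums 0"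
    using \<sigma> by (auto simp: defect_def)
  have prod0: "(t n - l) * \<sigma> n * v l (t n) = 0" if l: "l \<in> \<Lambda>" for l n
  proof -
    let ?x = "\<lambda>n. (t n - l) * \<sigma> n * v l (t n)"
    have bound: "cmod ((t n - l) * \<sigma> n) \<le> (1 + cmod l) * C" for n
    proof -
      have "cmod (t n - l) \<le> cmod (t n) + cmod l" by (rule norm_triangle_ineq4)
      also have "\<dots> \<le> (1 + cmod l) * (1 + cmod (t n))" by (simp add: algebra_simps)
      finally have "cmod (t n - l) * cmod (\<sigma> n) \<le> (1 + cmod l) * (1 + cmod (t n)) * cmod (\<sigma> n)"
        by (rule mult_right_mono) simp
      also have "\<dots> = (1 + cmod l) * (cmod (\<sigma> n) * (1 + cmod (t n)))" by (simp add: mult_ac)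
      also have "\<dots> \<le> (1 + cmod l) * C" by (intro mult_left_mono decay) simp
      finally show ?thesis by (simp add: norm_mult)
    qed
    have "summable (\<lambda>n. (cmod (?x n / of_real (\<nu> n)))\<^sup>2)"
    proof (rule l2_bounded_mult[OF summable_square_values[OF v_mem[OF l]]])
      show "cmod (?x n / of_real (\<nu> n)) \<le> (1 + cmod l) * C * cmod (v l (t n) / of_real (\<nu> n))" for n
        using mult_right_mono[OF bound[of n] norm_ge_zero[of "v l (t n) / of_real (\<nu> n)"]]
        by (simp add: norm_mult norm_divide)
    qed
    then obtain B where B: "B \<in> H" and Bt: "\<And>n. B (t n) = ?x n"
      by (rule interpolation) blast
    have "B = 0"
    proof (rule uniqueness_set[OF B])
      fix m assume m: "m \<in> \<Lambda>"
      show "B m = 0"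
      proof (cases "m \<in> range t")
        case True
        then obtain j where "m = t j" by blast
        then show ?thesis using Bt[of j] v_at[OF l m] by auto
      next
        case False
        \<comment> \<open>Replacing \<open>l\<close> by \<open>m\<close> cancels the denominators
          \<open>m - t n\<close> in the expansion of \<open>B\<close> at \<open>m\<close>, which
          becomes a multiple of the annihilation relation for \<open>m\<close>.\<close>
        obtain c where c: "c \<noteq> 0" "\<And>z. (z - l) * v l z = c * ((z - m) * v m z)"
          by (rule v_ratio[OF l m]) blast
        have "B (t n) / deriv F (t n) * (F m / (m - t n)) =
            - F m * c * (\<sigma> n * v m (t n) / deriv F (t n))" for n
        proof -
          define x where "x = m - t n"
          have x: "x \<noteq> 0" using False by (auto simp: x_def)
          have "B (t n) = \<sigma> n * ((t n - l) * v l (t n))" by (simp add: Bt)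
          also have "\<dots> = \<sigma> n * (c * ((t n - m) * v m (t n)))" by (simp only: c(2))
          also have "\<dots> = - (m - t n) * (\<sigma> n * c * v m (t n))" by (simp add: algebra_simps)
          finally have "B (t n) = - x * (\<sigma> n * c * v m (t n))" by (simp only: x_def)
          then show ?thesis
            unfolding x_def[symmetric] using x deriv_F_nonzero[of n] by (simp add: field_simps)
        qed
        then have "(\<lambda>n. - F m * c * (\<sigma> n * v m (t n) / deriv F (t n))) sums B m"
          using cauchy_expansion[OF B False] by simp
        moreover have "(\<lambda>n. - F m * c * (\<sigma> n * v m (t n) / deriv F (t n))) sums (- F m * c * 0)"
          by (intro sums_mult ann m)
        ultimately show ?thesis using sums_unique2 by fastforce
      qed
    qed
    then show ?thesis using Bt[of n] by simp
  qed
  have off: "\<sigma> n = 0" if "t n \<notin> \<Lambda>" for n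
  proof -
    obtain l where l: "l \<in> \<Lambda>" using \<Lambda>_nonempty by blast
    then show ?thesis using prod0[OF l, of n] v_nonzero[OF l that] that by auto
  qed
  show ?thesis
  proof (cases "t n \<in> \<Lambda>")
    case True
    \<comment> \<open>Only one term survives: \<open>\<sigma> j\<close> vanishes if
      \<open>t j\<close> is outside \<open>\<Lambda>\<close>, and \<open>v (t n)\<close> vanishes at
      the other points of \<open>\<Lambda>\<close>.\<close>
    have "\<sigma> j * v (t n) (t j) / deriv F (t j) = (if j = n then \<sigma> n / deriv F (t n) else 0)" for j
      using off[of j] v_at[OF True, of "t j"] injD[OF A3_distinct, of j n]
      by (cases "t j \<in> \<Lambda>") auto
    then have "(\<lambda>j. if j = n then \<sigma> n / deriv F (t n) else 0) sums 0"
      using ann[OF True] by simp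
    moreover have "(\<lambda>j. if j = n then \<sigma> n / deriv F (t n) else 0) sums (\<sigma> n / deriv F (t n))"
      using sums_single[of n "\<lambda>_. \<sigma> n / deriv F (t n)"] by simp
    ultimately have "\<sigma> n / deriv F (t n) = 0" using sums_unique2 by blast
    then show ?thesis using deriv_F_nonzero by simp
  qed (rule off)
qed

text \<open>Each shift lowers the growth exponent by one; a bounded sequence becomes decaying, hence
  zero. Undoing a shift replaces \<open>P\<close> by \<open>s + (z - p) * P\<close>, raising the
  degree bound by one.\<close>

lemma defect_polynomial:
  assumes "defect \<sigma>" and "\<And>n. cmod (\<sigma> n) \<le> C * (1 + cmod (t n)) ^ m"
  shows "\<exists>P. degree P \<le> m \<and> (\<forall>n. \<sigma> n = poly P (t n))"
  using assms
proof (induction m arbitrary: \<sigma> C)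
  case (0 \<sigma> C)
  obtain p where p: "F p \<noteq> 0" "p \<notin> \<Lambda>" by (rule regular_point)
  then have pt: "p \<notin> range t" using F_t by auto
  obtain s where s: "defect (\<lambda>n. (\<sigma> n - s) / (t n - p))" by (rule defect_shift[OF 0(1) p])
  obtain D where D: "D > 0" "\<And>n. 1 + cmod (t n) \<le> D * cmod (t n - p)"
    by (rule range_t_separated[OF pt]) blast
  have "(\<sigma> n - s) / (t n - p) = 0" for n
  proof (rule defect_decaying_zero[OF s])
    fix n
    have tp: "cmod (t n - p) > 0" using pt by auto
    have "cmod (\<sigma> n - s) \<le> C + cmod s"
      using norm_triangle_ineq4[of "\<sigma> n" s] 0(2)[of n] by simp
    then have "cmod (\<sigma> n - s) * (1 + cmod (t n)) \<le> (C + cmod s) * (D * cmod (t n - p))"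
      using D(2)[of n] by (intro mult_mono) (auto intro: order_trans[OF norm_ge_zero])
    then show "cmod ((\<sigma> n - s) / (t n - p)) * (1 + cmod (t n)) \<le> (C + cmod s) * D"
      using tp by (simp add: norm_divide divide_le_eq mult_ac)
  qed
  then have "\<sigma> n = poly [:s:] (t n)" for n using pt by (auto simp: divide_eq_0_iff)
  then show ?case by (intro exI[of _ "[:s:]"]) simp
next
  case (Suc m \<sigma> C)
  obtain p where p: "F p \<noteq> 0" "p \<notin> \<Lambda>" by (rule regular_point)
  then have pt: "p \<notin> range t" using F_t by auto
  obtain s where s: "defect (\<lambda>n. (\<sigma> n - s) / (t n - p))" by (rule defect_shift[OF Suc.prems(1) p])
  obtain D where D: "D > 0" "\<And>n. 1 + cmod (t n) \<le> D * cmod (t n - p)"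
    by (rule range_t_separated[OF pt]) blast
  have "cmod ((\<sigma> n - s) / (t n - p)) \<le> (C + cmod s) * D * (1 + cmod (t n)) ^ m" for n
  proof -
    have tp: "cmod (t n - p) > 0" using pt by auto
    have one: "1 \<le> (1 + cmod (t n)) ^ Suc m" by (intro one_le_power) simp
    have "cmod (\<sigma> n - s) \<le> C * (1 + cmod (t n)) ^ Suc m + cmod s * 1"
      using norm_triangle_ineq4[of "\<sigma> n" s] Suc.prems(2)[of n] by simp
    also have "\<dots> \<le> (C + cmod s) * (1 + cmod (t n)) ^ Suc m"
      unfolding distrib_right by (intro add_left_mono mult_left_mono one) simp
    finally have le: "cmod (\<sigma> n - s) \<le> (C + cmod s) * (1 + cmod (t n)) ^ m * (1 + cmod (t n))"
      by (simp add: mult_ac)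
    \<comment> \<open>The sign of \<open>C\<close> is not given; nonnegativity of this factor is
      read off from \<open>le\<close>.\<close>
    have "0 \<le> (C + cmod s) * (1 + cmod (t n)) ^ m"
    proof (rule ccontr)
      assume "\<not> ?thesis"
      then have "(C + cmod s) * (1 + cmod (t n)) ^ m * (1 + cmod (t n)) < 0"
        using add_pos_nonneg[OF zero_less_one norm_ge_zero[of "t n"]]
        by (intro mult_neg_pos[of "(C + cmod s) * (1 + cmod (t n)) ^ m"]) linarith+
      then show False using le norm_ge_zero[of "\<sigma> n - s"] by linarith
    qed
    then have "(C + cmod s) * (1 + cmod (t n)) ^ m * (1 + cmod (t n)) \<le>
        (C + cmod s) * (1 + cmod (t n)) ^ m * (D * cmod (t n - p))"
      using D(2)[of n] by (intro mult_left_mono)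
    with le show ?thesis
      using tp by (simp add: norm_divide divide_le_eq mult_ac)
  qed
  then obtain P where P: "degree P \<le> m" "\<And>n. (\<sigma> n - s) / (t n - p) = poly P (t n)"
    using Suc.IH[OF s] by blast
  have "\<sigma> n = poly ([:s:] + [:- p, 1:] * P) (t n)" for n
  proof -
    have "t n - p \<noteq> 0" using pt by auto
    then have "\<sigma> n - s = (t n - p) * poly P (t n)" using P(2)[of n] by (simp add: field_simps)
    then show ?thesis by (simp add: algebra_simps)
  qed
  moreover have "degree ([:s:] + [:- p, 1:] * P) \<le> Suc m"
  proof (rule degree_add_le)
    show "degree ([:- p, 1:] * P) \<le> Suc m"
      using degree_mult_le[of "[:- p, 1:]" P] P(1) by simp
  qed simp
  ultimately show ?case by blast
qed

text \<open>The squared modulus of the defect sequence is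
  \<open>(cmod (ip (W n) h))\<^sup>2 / weight F n\<close>, so the lower bound on the weights becomes
  polynomial growth. The degree bound does not depend on \<open>h\<close>.\<close>

lemma orthogonal_polynomial:
  assumes N: "N > 0" and growth: "(INF m. weight F m * (1 + cmod (t m)) powr N) > 0"
    and h: "h \<in> orth_complement (v ` \<Lambda>)"
  shows "\<exists>P. degree P \<le> nat \<lceil>N\<rceil> \<and>
    (\<forall>n. ip (W n) h * deriv F (t n) / of_real (\<nu> n) = poly P (t n))"
proof -
  let ?\<sigma> = "\<lambda>n. ip (W n) h * deriv F (t n) / of_real (\<nu> n)"
  let ?m = "nat \<lceil>N\<rceil>"
  define c where "c = (INF m. weight F m * (1 + cmod (t m)) powr N)"
  have c: "c > 0" using growth by (simp add: c_def)
  have c_le: "c \<le> weight F n * (1 + cmod (t n)) powr N" for n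
    unfolding c_def
    by (rule cINF_lower) (auto intro!: bdd_belowI[of _ 0] simp: weight_def)
  have hH: "h \<in> H" using h by (simp add: orth_complement_def)
  define S where "S = (\<Sum>n. (cmod (ip (W n) h))\<^sup>2)"
  have "cmod (?\<sigma> n) \<le> sqrt (S / c) * (1 + cmod (t n)) ^ ?m" for n
  proof (rule power2_le_imp_le)
    let ?r = "1 + cmod (t n)"
    have le_S: "(cmod (ip (W n) h))\<^sup>2 \<le> S"
      unfolding S_def using sum_le_suminf[OF R.summable_square_ip_w[OF hH], of "{n}"] by simp
    then have S0: "S \<ge> 0" by (rule order_trans[rotated]) simp
    \<comment> \<open>An even exponent makes the right side a square, so square roots can be
      taken.\<close>
    have "?r powr N \<le> ?r powr real (2 * ?m)"
    proof (rule powr_mono)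
      show "N \<le> real (2 * ?m)" using N by linarith
    qed simp
    also have "\<dots> = (?r ^ ?m)\<^sup>2"
      by (subst powr_realpow) (simp_all add: add_pos_nonneg power_even_eq)
    finally have powr_le: "?r powr N \<le> (?r ^ ?m)\<^sup>2" .
    have w: "weight F n > 0"
      using \<nu>_pos[of n] deriv_F_nonzero[of n] by (simp add: weight_def)
    have "(cmod (?\<sigma> n))\<^sup>2 = (cmod (ip (W n) h))\<^sup>2 / weight F n"
      using \<nu>_pos[of n] by (simp add: norm_mult norm_divide power_mult_distrib power_divide weight_def)
    also have "\<dots> \<le> S / weight F n" using w le_S by (intro divide_right_mono) auto
    also have "\<dots> \<le> S / c * ?r powr N"
      using mult_left_mono[OF c_le[of n] S0] c w by (simp add: field_simps)
    also have "\<dots> \<le> S / c * (?r ^ ?m)\<^sup>2"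
      using powr_le S0 c by (intro mult_left_mono) auto
    also have "\<dots> = (sqrt (S / c) * ?r ^ ?m)\<^sup>2"
      using S0 c by (simp add: power_mult_distrib)
    finally show "(cmod (?\<sigma> n))\<^sup>2 \<le> (sqrt (S / c) * ?r ^ ?m)\<^sup>2" .
    show "0 \<le> sqrt (S / c) * ?r ^ ?m" using S0 c by simp
  qed
  then show ?thesis by (rule defect_polynomial[OF defect_of_orthogonal[OF h]])
qed

section \<open>From polynomials to finite dimension and completeness\<close>

lemma zero_if_coefficients_zero:
  assumes h: "h \<in> H" and zero: "\<And>n. ip (W n) h = 0"
  shows "h = 0"
proof (rule ip_definite[OF h])
  have "(\<lambda>n. 0) sums ip h h" using parseval_values[OF h h] by (simp add: zero)
  then show "ip h h = 0" using sums_unique2 sums_zero by blast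
qed

lemma coefficients_zero_if_polynomial_zero:
  assumes "ip (W n) h * deriv F (t n) / of_real (\<nu> n) = 0"
  shows "ip (W n) h = 0"
  using assms deriv_F_nonzero[of n] \<nu>_pos[of n] by simp

lemma subspace_orth_complement:
  assumes "S \<subseteq> H" shows "cfun.subspace (orth_complement S)"
  unfolding orth_complement_def
  using assms by (intro cfun.subspaceI)
    (auto simp: zero_mem add_mem scale_mem ip_zero ip_add ip_scale subset_iff simp del: plus_fun_apply)

text \<open>The first \<open>nat \<lceil>N\<rceil> + 1\<close> coefficients determine
  \<open>h\<close>: if they vanish, \<open>P\<close> has more distinct roots than its degree allows.
  The functionals are written \<open>ip h (W i)\<close> to be linear in \<open>h\<close>.\<close>

lemma finite_dim_orth_complement:
  assumes N: "N > 0" and growth: "(INF m. weight F m * (1 + cmod (t m)) powr N) > 0"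
  shows "finite_dim (orth_complement (v ` \<Lambda>))"
proof (rule finite_dim_of_functionals[where \<phi> = "\<lambda>i h. ip h (W i)" and m = "Suc (nat \<lceil>N\<rceil>)"])
  show "cfun.subspace (orth_complement (v ` \<Lambda>))"
    using v_mem by (intro subspace_orth_complement) auto
  show "ip (f + g) (W i) = ip f (W i) + ip g (W i)"
    if "f \<in> orth_complement (v ` \<Lambda>)" "g \<in> orth_complement (v ` \<Lambda>)" for i f g
    using that R.w_mem[of i] by (simp only: orth_complement_def mem_Collect_eq ip_add)
  show "ip (cscale c f) (W i) = c * ip f (W i)" if "f \<in> orth_complement (v ` \<Lambda>)" for i c f
    using that R.w_mem[of i] by (simp only: orth_complement_def mem_Collect_eq ip_scale)
  show "{h \<in> orth_complement (v ` \<Lambda>). \<forall>i<Suc (nat \<lceil>N\<rceil>). ip h (W i) = 0} \<subseteq> {0}"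
  proof
    fix h assume "h \<in> {h \<in> orth_complement (v ` \<Lambda>). \<forall>i<Suc (nat \<lceil>N\<rceil>). ip h (W i) = 0}"
    then have h: "h \<in> orth_complement (v ` \<Lambda>)"
      and zero: "\<forall>i<Suc (nat \<lceil>N\<rceil>). ip h (W i) = 0" by blast+
    have hH: "h \<in> H" using h by (simp add: orth_complement_def)
    obtain P where deg: "degree P \<le> nat \<lceil>N\<rceil>"
      and P: "\<And>n. ip (W n) h * deriv F (t n) / of_real (\<nu> n) = poly P (t n)"
      using orthogonal_polynomial[OF N growth h] by blast
    have "P = 0"
    proof (rule ccontr)
      assume "P \<noteq> 0"
      have "poly P (t i) = 0" if "i < Suc (nat \<lceil>N\<rceil>)" for i
        using P[of i] zero that ip_cnj[OF hH R.w_mem, of i] by simp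
      then have "t ` {..<Suc (nat \<lceil>N\<rceil>)} \<subseteq> {z. poly P z = 0}" by auto
      then have "card (t ` {..<Suc (nat \<lceil>N\<rceil>)}) \<le> card {z. poly P z = 0}"
        using poly_roots_finite[OF \<open>P \<noteq> 0\<close>] by (intro card_mono)
      also have "\<dots> \<le> degree P" using \<open>P \<noteq> 0\<close> by (rule card_poly_roots_bound)
      finally show False
        using deg A3_distinct by (simp add: card_image inj_on_subset)
    qed
    then have "h = 0"
      using P by (intro zero_if_coefficients_zero[OF hH] coefficients_zero_if_polynomial_zero) simp
    then show "h \<in> {0}" by simp
  qed
qed

text \<open>Since \<open>weight F n\<close> times the squared modulus of \<open>P (t n)\<close> is
  the summable \<open>(cmod (ip (W n) h))\<^sup>2\<close>, and a nonzero \<open>P\<close> is bounded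
  below at all but finitely many \<open>t n\<close>, the weights would be summable unless
  \<open>P = 0\<close>.\<close>

lemma complete_biorthogonal:
  assumes N: "N > 0" and growth: "(INF m. weight F m * (1 + cmod (t m)) powr N) > 0"
    and inf: "(\<Sum>n. ennreal (weight F n)) = \<infinity>"
  shows "complete_system v \<Lambda>"
proof (rule complete_system_if_orth_complement_trivial[OF hilbert])
  show "v ` \<Lambda> \<subseteq> H" using v_mem by blast
  show "orth_complement (v ` \<Lambda>) \<subseteq> {0}"
  proof
    fix h assume h: "h \<in> orth_complement (v ` \<Lambda>)"
    then have hH: "h \<in> H" by (simp add: orth_complement_def)
    obtain P where P: "\<And>n. ip (W n) h * deriv F (t n) / of_real (\<nu> n) = poly P (t n)"
      using orthogonal_polynomial[OF N growth h] by blast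
    have "P = 0"
    proof (rule ccontr)
      assume "P \<noteq> 0"
      obtain \<delta> r where \<delta>: "\<delta> > 0" and far: "\<And>z. cmod z > r \<Longrightarrow> \<delta> \<le> cmod (poly P z)"
      proof (cases "degree P = 0")
        case True
        then obtain a where "P = [:a:]" by (rule degree_eq_zeroE)
        with \<open>P \<noteq> 0\<close> show thesis by (intro that[of "cmod a" 0]) auto
      next
        case False
        then have "filterlim (poly P) at_infinity at_infinity"
          by (intro filterlim_poly_at_infinity) simp
        then have "\<forall>\<^sub>F z in at_infinity. 1 \<le> cmod (poly P z)"
          unfolding filterlim_at_infinity[OF order.refl] by (rule allE[of _ 1]) simp
        then obtain r where "\<And>z. r \<le> cmod z \<Longrightarrow> 1 \<le> cmod (poly P z)"
          unfolding eventually_at_infinity by blast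
        then show thesis by (intro that[of 1 r]) auto
      qed
      have summable_weight: "summable (\<lambda>n. weight F n)"
      proof (rule summable_comparison_test_ev)
        show "summable (\<lambda>n. (1 / \<delta>\<^sup>2) * (cmod (ip (W n) h))\<^sup>2)"
          by (intro summable_mult R.summable_square_ip_w hH)
        have "eventually (\<lambda>n. n \<notin> {n. cmod (t n) \<le> r}) sequentially"
          using finite_t_bounded[of r]
          unfolding cofinite_eq_sequentially[symmetric] eventually_cofinite by simp
        then show "\<forall>\<^sub>F n in sequentially. norm (weight F n) \<le> (1 / \<delta>\<^sup>2) * (cmod (ip (W n) h))\<^sup>2"
        proof (rule eventually_mono)
          fix n assume "n \<notin> {n. cmod (t n) \<le> r}"
          then have "\<delta>\<^sup>2 \<le> (cmod (poly P (t n)))\<^sup>2"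
            using far[of "t n"] \<delta> by (intro power_mono) auto
          then have "weight F n * \<delta>\<^sup>2 \<le> weight F n * (cmod (poly P (t n)))\<^sup>2"
            by (rule mult_left_mono) (simp add: weight_def)
          also have "\<dots> = (cmod (ip (W n) h))\<^sup>2"
            unfolding P[symmetric] using \<nu>_pos[of n] deriv_F_nonzero[of n]
            by (simp add: norm_mult norm_divide power_mult_distrib power_divide weight_def)
          finally show "norm (weight F n) \<le> (1 / \<delta>\<^sup>2) * (cmod (ip (W n) h))\<^sup>2"
            using \<delta> by (simp add: field_simps weight_def)
        qed
      qed
      have "(\<Sum>n. ennreal (weight F n)) = ennreal (\<Sum>n. weight F n)"
        by (rule suminf_ennreal2[OF _ summable_weight]) (simp add: weight_def)
      with inf show False by simp
    qed
    then have "h = 0"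
      using P by (intro zero_if_coefficients_zero[OF hH] coefficients_zero_if_polynomial_zero) simp
    then show "h \<in> {0}" by simp
  qed
qed

end

theorem theorem1p2:
  fixes H :: "(complex \<Rightarrow> complex) set"
    and ip :: "(complex \<Rightarrow> complex) \<Rightarrow> (complex \<Rightarrow> complex) \<Rightarrow> complex"
    and k :: "complex \<Rightarrow> (complex \<Rightarrow> complex)"
    and t :: "nat \<Rightarrow> complex"
    and F :: "complex \<Rightarrow> complex"
    and b :: "nat \<Rightarrow> real"
  assumes R: "class_R H ip k t"
    and F: "class_R.generating_function H ip k t F"
    and b: "b = class_R.weight ip k t F"
    and growth: "\<exists>N::real. N > 0 \<and> (INF m. b m * (1 + cmod (t m)) powr N) > 0"
  shows "(\<forall>(\<Lambda> :: complex set) w.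
            pre_hilbert.exact_system H ip k \<Lambda> \<and> pre_hilbert.biorthogonal H ip k w \<Lambda> \<longrightarrow>
              finite_dim (pre_hilbert.orth_complement H ip (w ` \<Lambda>)))
       \<and> ((\<Sum>n. ennreal (b n)) = \<infinity> \<longrightarrow>
          (\<forall>(\<Lambda> :: complex set) w.
            pre_hilbert.exact_system H ip k \<Lambda> \<and> pre_hilbert.biorthogonal H ip k w \<Lambda> \<longrightarrow>
              pre_hilbert.complete_system H ip w \<Lambda>))"
proof -
  interpret class_R H ip k t by (rule R)
  obtain N where N: "N > 0" "(INF m. weight F m * (1 + cmod (t m)) powr N) > 0"
    using growth unfolding b by blast
  have sys: "exact_kernel_system H ip k t F \<Lambda> w"
    if "exact_system k \<Lambda> \<and> biorthogonal k w \<Lambda>" for \<Lambda> w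
    using F that by unfold_locales auto
  show ?thesis
    unfolding b
    using exact_kernel_system.finite_dim_orth_complement[OF sys N]
      exact_kernel_system.complete_biorthogonal[OF sys N] by blast
qed

end
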